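(* Let $f\in L^{p'}(\Omega)$ and let $\tilde\tau_h\in\mathcal K(\mathcal F_h)=\{v_h\in V_h:\ b(v_h,q_h)=-\int_\Omega f q_h\ \ \forall q_h\in Q_h\}$. Let $\tilde{\mathcal A}_{h,\tilde\tau_h}:Z_h\to(Z_h)'$ be defined by $\langle\tilde{\mathcal A}_{h,\tilde\tau_h}w_h,v_h\rangle=a_h(w_h+\tilde\tau_h,v_h)$ for $w_h,v_h\in Z_h$. Then, for $w_h\in Z_h$, $$\frac{\langle\tilde{\mathcal A}_{h,\tilde\tau_h}w_h,w_h\rangle}{|||w_h|||_{a_h}}\to\infty\quad\text{as}\quad |||w_h|||_{a_h}\to\infty .$$
   Context: Setting. $\Omega\subset\mathbb R^2$ is an open, bounded, connected polygonal domain with Lipschitz boundary; $p\in(1,\infty)$ and the integer $k\ge0$ are fixed; $p'=p/(p-1)$. $\Omega_h$ (a member of a family of meshes) is a decomposition of $\Omega$ into nonoverlapping polygonal elements $E$; $h_E$, $|E|$, $x_E$, $\mathcal E_E$ are the diameter, area, barycenter and set of edges of $E$; $h_e$, $x_e$, $n_e$ are the length, midpoint and a fixed unit normal of an edge $e$. Mesh regularity: there is $\rho>0$ (uniform over the family) such that every $E$ is star-shaped with respect to a disk of radius $\ge\rho h_E$ and $h_e\ge\rho h_E$ for all $e\in\mathcal E_E$. $\mathcal P^\ell(Y)$: polynomials of total degree $\le\ell$ on $Y$ ($\mathcal P^{-1}=\{0\}$); $\pi_E$: $L^2(E)$-orthogonal projector of vector fields onto $\mathcal P^k(E)^2$. $\operatorname{rot}w=\partial_1w_2-\partial_2w_1$;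 $(a_1,a_2)^\perp=(-a_2,a_1)$. Spaces. $V_h(E)=\{v\in H(\mathrm{div};E)\cap H(\mathrm{rot};E): v\cdot n_e\in\mathcal P^k(e)\ \forall e\in\mathcal E_E,\ \nabla\cdot v\in\mathcal P^k(E),\ \operatorname{rot}v\in\mathcal P^{k-1}(E)\}$. $\mathrm{dof}_E(v)\in\mathbb R^{N_E}$, $N_E=\dim V_h(E)$, is the vector of degrees of freedom: (i) $\frac1{h_e}\int_e (v\cdot n_e)m$ for each $e\in\mathcal E_E$, $m=((x-x_e)/h_e)^\alpha$, $0\le\alpha\le k$ ($x$ a length coordinate on $e$); (ii) $\frac{h_E}{|E|}\int_E v\cdot\nabla m$, $m=((x-x_E)/h_E)^{\alpha}$, $1\le|\alpha|\le k$; (iii) $\frac1{|E|}\int_E v\cdot\left(\frac{x-x_E}{h_E}\right)^\perp m$, $m=((x-x_E)/h_E)^{\alpha}$, $|\alpha|\le k-1$. $V_h=\{v\in H(\mathrm{div};\Omega): v|_E\in V_h(E)\ \forall E\in\Omega_h\}$, $Q_h=\{q\in L^1(\Omega):q|_E\in\mathcal P^k(E)\ \forall E\in\Omega_h\}$, $Z_h=\{v\in V_h:\nabla\cdot v=0\}$. Forms and norm. $b(v,q)=\int_\Omega(\nabla\cdot v)q$; $a_E(w,v)=\int_E|w|^{p'-2}w\cdot v$; $s_E(w,v)=h_E^2|\mathrm{dof}_E(w)|^{p'-2}\mathrm{dof}_E(w)\cdot\mathrm{dof}_E(v)$ (with $|A|^{p'-2}A:=0$ at $A=0$); $a_h(w,v)=\sum_{E\in\Omega_h}[a_E(\pi_Ew,\pi_Ev)+s_E(w-\pi_Ew,v-\pi_Ev)]$;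 $|||w|||_{a_h}=a_h(w,w)^{1/p'}$. *)

theory Defs
  imports "HOL-Analysis.Analysis"
begin

type_synonym pt = "real^2"

text \<open>
  Elements of Lebesgue and Sobolev-type spaces are represented by functions on the whole plane, of
  which only the values on the relevant set (domain, element or edge) are ever used; functions
  equal almost everywhere there are not identified.
\<close>

definition conj_exponent :: "real \<Rightarrow> real" where
  "conj_exponent p = p / (p - 1)"

definition perp :: "pt \<Rightarrow> pt" where
  "perp a = vector [- (a $ 2), a $ 1]"


subsection \<open>Polynomials\<close>

definition mono2 :: "nat \<times> nat \<Rightarrow> pt \<Rightarrow> real" where
  "mono2 \<alpha> x = (x $ 1) ^ fst \<alpha> * (x $ 2) ^ snd \<alpha>"

text \<open>The degree bound is an integer so that bound \<open>-1\<close> gives the zero space.\<close>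

definition poly_space :: "int \<Rightarrow> pt set \<Rightarrow> (pt \<Rightarrow> real) set" where
  "poly_space l Y =
     {q. \<exists>c. \<forall>x\<in>Y. q x = (\<Sum>\<alpha> | int (fst \<alpha> + snd \<alpha>) \<le> l. c \<alpha> * mono2 \<alpha> x)}"

definition poly_fields :: "int \<Rightarrow> pt set \<Rightarrow> (pt \<Rightarrow> pt) set" where
  "poly_fields l Y = {q. \<forall>i. (\<lambda>x. q x $ i) \<in> poly_space l Y}"


subsection \<open>Lebesgue spaces and weak derivatives\<close>

definition Lp_space :: "real \<Rightarrow> pt set \<Rightarrow> (pt \<Rightarrow> 'a::euclidean_space) set" where
  "Lp_space q S = {f. f \<in> borel_measurable (lebesgue_on S) \<and>
                      integrable (lebesgue_on S) (\<lambda>x. norm (f x) powr q)}"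

definition grad :: "(pt \<Rightarrow> real) \<Rightarrow> pt \<Rightarrow> pt" where
  "grad \<phi> x = (THE D. GDERIV \<phi> x :> D)"

primrec C_n :: "nat \<Rightarrow> (pt \<Rightarrow> real) \<Rightarrow> bool" where
  "C_n 0 \<phi> \<longleftrightarrow> continuous_on UNIV \<phi>"
| "C_n (Suc n) \<phi> \<longleftrightarrow> \<phi> differentiable_on UNIV \<and> (\<forall>i. C_n n (\<lambda>x. grad \<phi> x $ i))"

definition smooth :: "(pt \<Rightarrow> real) \<Rightarrow> bool" where
  "smooth \<phi> \<longleftrightarrow> (\<forall>n. C_n n \<phi>)"

definition test_functions :: "pt set \<Rightarrow> (pt \<Rightarrow> real) set" where
  "test_functions S = {\<phi>. smooth \<phi> \<and> compact (closure {x. \<phi> x \<noteq> 0}) \<and> closure {x. \<phi> x \<noteq> 0} \<subseteq> S}"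

definition weak_div :: "pt set \<Rightarrow> (pt \<Rightarrow> pt) \<Rightarrow> (pt \<Rightarrow> real) \<Rightarrow> bool" where
  "weak_div S v d \<longleftrightarrow> d \<in> Lp_space 2 S \<and>
     (\<forall>\<phi>\<in>test_functions S.
        (LINT x|lebesgue_on S. v x \<bullet> grad \<phi> x) = - (LINT x|lebesgue_on S. d x * \<phi> x))"

text \<open>
  For smooth \<open>v\<close> integration by parts of \<open>(\<partial>\<^sub>1 v\<^sub>2 - \<partial>\<^sub>2 v\<^sub>1) \<phi>\<close> moves the derivatives to
  \<open>- v\<^sub>2 \<partial>\<^sub>1 \<phi> + v\<^sub>1 \<partial>\<^sub>2 \<phi> = - v \<bullet> perp (grad \<phi>)\<close>.
\<close>

definition weak_rot :: "pt set \<Rightarrow> (pt \<Rightarrow> pt) \<Rightarrow> (pt \<Rightarrow> real) \<Rightarrow> bool" where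
  "weak_rot S v r \<longleftrightarrow> r \<in> Lp_space 2 S \<and>
     (\<forall>\<phi>\<in>test_functions S.
        (LINT x|lebesgue_on S. v x \<bullet> perp (grad \<phi> x)) = - (LINT x|lebesgue_on S. r x * \<phi> x))"

definition H_div :: "pt set \<Rightarrow> (pt \<Rightarrow> pt) set" where
  "H_div S = {v \<in> Lp_space 2 S. \<exists>d. weak_div S v d}"

definition H_rot :: "pt set \<Rightarrow> (pt \<Rightarrow> pt) set" where
  "H_rot S = {v \<in> Lp_space 2 S. \<exists>r. weak_rot S v r}"

definition divergence :: "pt set \<Rightarrow> (pt \<Rightarrow> pt) \<Rightarrow> pt \<Rightarrow> real" where
  "divergence S v = (SOME d. weak_div S v d)"


subsection \<open>Domains, polygons and meshes\<close>

text \<open>Near each boundary point the set is, in a rotated frame, the region below a Lipschitz graph.\<close>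

definition lipschitz_boundary :: "pt set \<Rightarrow> bool" where
  "lipschitz_boundary S \<longleftrightarrow> (\<forall>z\<in>frontier S. \<exists>u r s L (g :: real \<Rightarrow> real).
     norm u = 1 \<and> r > 0 \<and> s > 0 \<and> L-lipschitz_on UNIV g \<and>
     (\<forall>y1 y2. \<bar>y1\<bar> < r \<and> \<bar>y2\<bar> < s \<longrightarrow>
        (z + y1 *\<^sub>R u + y2 *\<^sub>R perp u \<in> S \<longleftrightarrow> y2 < g y1)))"

definition is_segment :: "pt set \<Rightarrow> bool" where
  "is_segment e \<longleftrightarrow> (\<exists>a b. a \<noteq> b \<and> e = closed_segment a b)"

definition polygonal_lipschitz_domain :: "pt set \<Rightarrow> bool" where
  "polygonal_lipschitz_domain S \<longleftrightarrow> S \<noteq> {} \<and> open S \<and> bounded S \<and> connected S \<and>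
     (\<exists>\<S>. finite \<S> \<and> (\<forall>e\<in>\<S>. is_segment e) \<and> frontier S = \<Union>\<S>) \<and>
     lipschitz_boundary S"

text \<open>
  A polygonal element is an open set together with its edges. The edges are part of the data:
  consecutive edges may be collinear (hanging nodes). An open set as below that is star-shaped with
  respect to a disk is the interior of a simple closed polygon.
\<close>

definition polygon_with_edges :: "pt set \<Rightarrow> pt set set \<Rightarrow> bool" where
  "polygon_with_edges E \<E> \<longleftrightarrow> E \<noteq> {} \<and> open E \<and> bounded E \<and> connected E \<and>
     finite \<E> \<and> (\<forall>e\<in>\<E>. is_segment e) \<and> frontier E = \<Union>\<E> \<and>
     (\<forall>e\<in>\<E>. \<forall>e'\<in>\<E>. e \<noteq> e' \<longrightarrow>
        (\<forall>x \<in> e \<inter> e'. x extreme_point_of e \<and> x extreme_point_of e'))"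

record mesh =
  elements :: "pt set set"
  edges :: "pt set \<Rightarrow> pt set set"
  normal :: "pt set \<Rightarrow> pt"

definition edge_length :: "pt set \<Rightarrow> real" where
  "edge_length e = diameter e"

definition edge_mid :: "pt set \<Rightarrow> pt" where
  "edge_mid e = (THE x. \<exists>a b. e = closed_segment a b \<and> x = midpoint a b)"

definition area :: "pt set \<Rightarrow> real" where
  "area E = measure lebesgue E"

definition barycenter :: "pt set \<Rightarrow> pt" where
  "barycenter E = (1 / area E) *\<^sub>R (LINT x|lebesgue_on E. x)"

definition is_mesh :: "pt set \<Rightarrow> mesh \<Rightarrow> bool" where
  "is_mesh \<Omega> M \<longleftrightarrow> finite (elements M) \<and>
     (\<forall>E\<in>elements M. polygon_with_edges E (edges M E) \<and> E \<subseteq> \<Omega>) \<and>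
     pairwise disjnt (elements M) \<and>
     closure \<Omega> = (\<Union>E\<in>elements M. closure E) \<and>
     (\<forall>E\<in>elements M. \<forall>e\<in>edges M E.
        norm (normal M e) = 1 \<and> (\<forall>x\<in>e. \<forall>y\<in>e. normal M e \<bullet> (x - y) = 0))"

definition mesh_regular :: "real \<Rightarrow> mesh \<Rightarrow> bool" where
  "mesh_regular \<rho> M \<longleftrightarrow> (\<forall>E\<in>elements M.
     (\<exists>c r. r > 0 \<and> r \<ge> \<rho> * diameter E \<and> ball c r \<subseteq> E \<and>
        (\<forall>y\<in>ball c r. \<forall>x\<in>E. closed_segment y x \<subseteq> E)) \<and>
     (\<forall>e\<in>edges M E. edge_length e \<ge> \<rho> * diameter E))"

definition regular_mesh_family :: "pt set \<Rightarrow> mesh set \<Rightarrow> bool" where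
  "regular_mesh_family \<Omega> \<M> \<longleftrightarrow> (\<forall>M\<in>\<M>. is_mesh \<Omega> M) \<and> (\<exists>\<rho>>0. \<forall>M\<in>\<M>. mesh_regular \<rho> M)"


subsection \<open>Normal traces and degrees of freedom\<close>

text \<open>The length coordinate on an edge vanishes at its midpoint and is oriented by the unit tangent
  \<open>perp (normal M e)\<close>.\<close>

definition edge_coord :: "mesh \<Rightarrow> pt set \<Rightarrow> pt \<Rightarrow> real" where
  "edge_coord M e x = (x - edge_mid e) \<bullet> perp (normal M e)"

definition edge_point :: "mesh \<Rightarrow> pt set \<Rightarrow> real \<Rightarrow> pt" where
  "edge_point M e s = edge_mid e + s *\<^sub>R perp (normal M e)"

definition edge_measure :: "pt set \<Rightarrow> real measure" where
  "edge_measure e = lebesgue_on {- edge_length e / 2 .. edge_length e / 2}"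

definition edge_integral :: "mesh \<Rightarrow> pt set \<Rightarrow> (pt \<Rightarrow> real) \<Rightarrow> real" where
  "edge_integral M e g = (LINT s|edge_measure e. g (edge_point M e s))"

text \<open>\<open>1\<close> if the fixed normal of the edge points out of the element, \<open>-1\<close> otherwise.\<close>

definition edge_sign :: "mesh \<Rightarrow> pt set \<Rightarrow> pt set \<Rightarrow> real" where
  "edge_sign M E e =
     (if \<exists>\<delta>>0. \<forall>t. 0 < t \<and> t < \<delta> \<longrightarrow> edge_mid e + t *\<^sub>R normal M e \<notin> E then 1 else - 1)"

text \<open>
  The normal trace of a field in \<open>H(div; E)\<close> is defined by duality through Green's formula. The
  predicate says that this functional is represented on each edge \<open>e\<close> by the integrable function
  \<open>g e\<close>, i.e. that \<open>v \<bullet> n\<^sub>e = g e\<close> on \<open>e\<close>.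
\<close>

definition has_normal_trace ::
    "mesh \<Rightarrow> pt set \<Rightarrow> (pt \<Rightarrow> pt) \<Rightarrow> (pt set \<Rightarrow> pt \<Rightarrow> real) \<Rightarrow> bool" where
  "has_normal_trace M E v g \<longleftrightarrow>
     (\<forall>e\<in>edges M E. integrable (edge_measure e) (\<lambda>s. g e (edge_point M e s))) \<and>
     (\<exists>d. weak_div E v d \<and>
        (\<forall>\<phi>. smooth \<phi> \<longrightarrow>
           (LINT x|lebesgue_on E. v x \<bullet> grad \<phi> x + d x * \<phi> x) =
           (\<Sum>e\<in>edges M E. edge_sign M E e * edge_integral M e (\<lambda>x. g e x * \<phi> x))))"

definition normal_trace :: "mesh \<Rightarrow> pt set \<Rightarrow> (pt \<Rightarrow> pt) \<Rightarrow> pt set \<Rightarrow> pt \<Rightarrow> real" where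
  "normal_trace M E v = (SOME g. has_normal_trace M E v g)"

definition scaled_mono :: "pt set \<Rightarrow> nat \<times> nat \<Rightarrow> pt \<Rightarrow> real" where
  "scaled_mono E \<alpha> x = mono2 \<alpha> ((x - barycenter E) /\<^sub>R diameter E)"

datatype dof_index = Edge_Dof "pt set" nat | Grad_Dof "nat \<times> nat" | Perp_Dof "nat \<times> nat"

definition dof_indices :: "mesh \<Rightarrow> nat \<Rightarrow> pt set \<Rightarrow> dof_index set" where
  "dof_indices M k E =
     {Edge_Dof e \<alpha> | e \<alpha>. e \<in> edges M E \<and> \<alpha> \<le> k} \<union>
     {Grad_Dof \<alpha> | \<alpha>. 1 \<le> fst \<alpha> + snd \<alpha> \<and> fst \<alpha> + snd \<alpha> \<le> k} \<union>
     {Perp_Dof \<alpha> | \<alpha>. int (fst \<alpha> + snd \<alpha>) \<le> int k - 1}"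

primrec dof :: "mesh \<Rightarrow> pt set \<Rightarrow> (pt \<Rightarrow> pt) \<Rightarrow> dof_index \<Rightarrow> real" where
  "dof M E v (Edge_Dof e \<alpha>) =
     (1 / edge_length e) *
       edge_integral M e (\<lambda>x. normal_trace M E v e x * (edge_coord M e x / edge_length e) ^ \<alpha>)"
| "dof M E v (Grad_Dof \<alpha>) =
     (diameter E / area E) * (LINT x|lebesgue_on E. v x \<bullet> grad (scaled_mono E \<alpha>) x)"
| "dof M E v (Perp_Dof \<alpha>) =
     (1 / area E) *
       (LINT x|lebesgue_on E. (v x \<bullet> perp ((x - barycenter E) /\<^sub>R diameter E)) * scaled_mono E \<alpha> x)"

definition dof_inner :: "mesh \<Rightarrow> nat \<Rightarrow> pt set \<Rightarrow> (pt \<Rightarrow> pt) \<Rightarrow> (pt \<Rightarrow> pt) \<Rightarrow> real" where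
  "dof_inner M k E w v = (\<Sum>i\<in>dof_indices M k E. dof M E w i * dof M E v i)"

definition dof_norm :: "mesh \<Rightarrow> nat \<Rightarrow> pt set \<Rightarrow> (pt \<Rightarrow> pt) \<Rightarrow> real" where
  "dof_norm M k E w = sqrt (dof_inner M k E w w)"


subsection \<open>Discrete spaces and forms\<close>

definition V_loc :: "mesh \<Rightarrow> nat \<Rightarrow> pt set \<Rightarrow> (pt \<Rightarrow> pt) set" where
  "V_loc M k E = {v \<in> H_div E \<inter> H_rot E.
     (\<exists>g. has_normal_trace M E v g \<and> (\<forall>e\<in>edges M E. g e \<in> poly_space (int k) e)) \<and>
     (\<exists>d\<in>poly_space (int k) E. weak_div E v d) \<and>
     (\<exists>r\<in>poly_space (int k - 1) E. weak_rot E v r)}"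

definition V_h :: "pt set \<Rightarrow> mesh \<Rightarrow> nat \<Rightarrow> (pt \<Rightarrow> pt) set" where
  "V_h \<Omega> M k = {v \<in> H_div \<Omega>. \<forall>E\<in>elements M. v \<in> V_loc M k E}"

definition Q_h :: "pt set \<Rightarrow> mesh \<Rightarrow> nat \<Rightarrow> (pt \<Rightarrow> real) set" where
  "Q_h \<Omega> M k = {q \<in> Lp_space 1 \<Omega>. \<forall>E\<in>elements M. q \<in> poly_space (int k) E}"

definition Z_h :: "pt set \<Rightarrow> mesh \<Rightarrow> nat \<Rightarrow> (pt \<Rightarrow> pt) set" where
  "Z_h \<Omega> M k = {v \<in> V_h \<Omega> M k. weak_div \<Omega> v (\<lambda>_. 0)}"

definition b_form :: "pt set \<Rightarrow> (pt \<Rightarrow> pt) \<Rightarrow> (pt \<Rightarrow> real) \<Rightarrow> real" where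
  "b_form \<Omega> v q = (LINT x|lebesgue_on \<Omega>. divergence \<Omega> v x * q x)"

definition K_set :: "pt set \<Rightarrow> mesh \<Rightarrow> nat \<Rightarrow> (pt \<Rightarrow> real) \<Rightarrow> (pt \<Rightarrow> pt) set" where
  "K_set \<Omega> M k f = {v \<in> V_h \<Omega> M k.
     \<forall>q\<in>Q_h \<Omega> M k. b_form \<Omega> v q = - (LINT x|lebesgue_on \<Omega>. f x * q x)}"

definition L2_proj :: "nat \<Rightarrow> pt set \<Rightarrow> (pt \<Rightarrow> pt) \<Rightarrow> pt \<Rightarrow> pt" where
  "L2_proj k E v = (SOME q. q \<in> poly_fields (int k) E \<and>
     (\<forall>r\<in>poly_fields (int k) E. (LINT x|lebesgue_on E. (v x - q x) \<bullet> r x) = 0))"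

text \<open>In the two forms below \<open>q\<close> stands for the conjugate exponent. At a vanishing argument the
  inner product factor is zero, whatever the value of \<open>powr\<close>.\<close>

definition a_loc :: "real \<Rightarrow> pt set \<Rightarrow> (pt \<Rightarrow> pt) \<Rightarrow> (pt \<Rightarrow> pt) \<Rightarrow> real" where
  "a_loc q E w v = (LINT x|lebesgue_on E. norm (w x) powr (q - 2) * (w x \<bullet> v x))"

definition s_loc :: "mesh \<Rightarrow> nat \<Rightarrow> real \<Rightarrow> pt set \<Rightarrow> (pt \<Rightarrow> pt) \<Rightarrow> (pt \<Rightarrow> pt) \<Rightarrow> real" where
  "s_loc M k q E w v = (diameter E)\<^sup>2 * (dof_norm M k E w powr (q - 2) * dof_inner M k E w v)"

definition a_h :: "mesh \<Rightarrow> nat \<Rightarrow> real \<Rightarrow> (pt \<Rightarrow> pt) \<Rightarrow> (pt \<Rightarrow> pt) \<Rightarrow> real" where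
  "a_h M k q w v = (\<Sum>E\<in>elements M.
     a_loc q E (L2_proj k E w) (L2_proj k E v) +
     s_loc M k q E (\<lambda>x. w x - L2_proj k E w x) (\<lambda>x. v x - L2_proj k E v x))"

definition a_h_norm :: "mesh \<Rightarrow> nat \<Rightarrow> real \<Rightarrow> (pt \<Rightarrow> pt) \<Rightarrow> real" where
  "a_h_norm M k q w = a_h M k q w w powr (1 / q)"

text \<open>The operator \<open>w \<mapsto> \<langle>A w, \<cdot>\<rangle>\<close>, to be applied to arguments in \<open>Z_h\<close>.\<close>

definition shifted_op ::
    "mesh \<Rightarrow> nat \<Rightarrow> real \<Rightarrow> (pt \<Rightarrow> pt) \<Rightarrow> (pt \<Rightarrow> pt) \<Rightarrow> (pt \<Rightarrow> pt) \<Rightarrow> real" where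
  "shifted_op M k q \<tau> w = (\<lambda>v. a_h M k q (\<lambda>x. w x + \<tau> x) v)"

end

theory Submission
  imports Defs "HOL-Real_Asymp.Real_Asymp"
begin

text \<open>
  Write \<open>q > 1\<close> for the conjugate exponent. If \<open>y = w + t\<close> in an inner product space, the pairing of
  \<open>|y| powr (q - 2) * y\<close> with \<open>w\<close> is at least \<open>|y| powr q - |y| powr (q - 1) * |t|\<close>, hence at
  least \<open>c * |w| powr q - C * |t| powr q\<close> with \<open>c > 0\<close> and \<open>C\<close> depending on \<open>q\<close> only. Integrated for
  the projections, applied to the vectors of degrees of freedom and summed over the elements, this
  gives \<open>a_h (w + \<tau>, w) \<ge> c * a_h (w, w) - C * a_h (\<tau>, \<tau>)\<close>; the quotient therefore grows like the
  norm to the power \<open>q - 1\<close>.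

  What makes this meaningful is that \<open>v \<mapsto> dof (v - \<pi> v)\<close> is additive although projection and normal
  trace are chosen by \<open>SOME\<close>: both must exist and be unique where they are used. The trace of the
  polynomial \<open>\<pi> v\<close> exists by Green's formula on a polygon, which Fubini's theorem reduces to the
  fundamental theorem of calculus on lines; the sign of the normal may be absorbed into the trace.
\<close>


section \<open>Polynomials and local projections\<close>

text \<open>The definitions leave two kinds of freedom. A field counts only by its values on
  \<open>E\<close>, so a projection is arbitrary off the open element, in particular on the edges;
  and a normal trace is any integrable representative, fixed only through its integrals. Hence
  equalities of fields are proved pointwise on \<open>E\<close>, and equalities of traces only as
  equalities of weighted edge integrals, which is all that \<open>dof\<close> sees. Green's formula
  has an obstacle of its own: an element is an open set with an unordered set of edges, with neither
  a cyclic order nor an outward orientation. The boundary term is therefore read off the indicator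
  of the element: its drop across an edge, along a coordinate line, gives the sign of the
  corresponding component of the outer normal. Since the integral of a nonintegrable function is 0,
  each use of linearity carries its own integrability argument.\<close>

lemma finite_bounded_pairs: "finite {\<alpha>. int (fst \<alpha> + snd \<alpha>) \<le> l}"
proof (rule finite_subset)
  show "{\<alpha>. int (fst \<alpha> + snd \<alpha>) \<le> l} \<subseteq> {..nat l} \<times> {..nat l}" by auto
qed auto


section \<open>Gradients and smoothness of polynomials\<close>

text \<open>\<open>grad\<close> is a definite description, so it says something only once the
  gradient is known to exist and to be unique. The candidate is the Riesz representative
  \<open>adjoint D 1\<close> of the derivative \<open>D\<close>.\<close>

lemma GDERIV_grad:
  assumes "\<phi> differentiable (at x)"
  shows "GDERIV \<phi> x :> grad \<phi> x"
proof -
  from assms obtain D where D: "(\<phi> has_derivative D) (at x)" by (auto simp: differentiable_def)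
  then have "bounded_linear D" by (rule has_derivative_bounded_linear)
  then have "D = (\<lambda>h. h \<bullet> adjoint D 1)"
    by (auto simp: adjoint_works bounded_linear.linear)
  with D have ex: "GDERIV \<phi> x :> adjoint D 1" unfolding gderiv_def by simp
  have "D1 = D2" if "GDERIV \<phi> x :> D1" "GDERIV \<phi> x :> D2" for D1 D2
  proof -
    from that have "(\<lambda>h. h \<bullet> D1) = (\<lambda>h. h \<bullet> D2)"
      unfolding gderiv_def by (rule has_derivative_unique)
    then have "\<forall>h. h \<bullet> D1 = h \<bullet> D2" by meson
    then show ?thesis by (simp add: vector_eq_ldot)
  qed
  with ex show ?thesis unfolding grad_def by (metis (no_types, lifting) theI)
qed

lemma grad_eqI:
  assumes "GDERIV \<phi> x :> D"
  shows "grad \<phi> x = D"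
proof -
  from assms have "\<phi> differentiable (at x)" unfolding gderiv_def differentiable_def by blast
  then have "GDERIV \<phi> x :> grad \<phi> x" by (rule GDERIV_grad)
  with assms have "(\<lambda>h. h \<bullet> grad \<phi> x) = (\<lambda>h. h \<bullet> D)"
    unfolding gderiv_def by (meson has_derivative_unique)
  then have "\<forall>h. h \<bullet> grad \<phi> x = h \<bullet> D" by meson
  then show ?thesis by (simp add: vector_eq_ldot)
qed

lemma bounded_linear_GDERIV:
  fixes f :: "pt \<Rightarrow> real"
  assumes "bounded_linear f"
  shows "GDERIV f x :> adjoint f 1"
proof -
  have "f = (\<lambda>h. h \<bullet> adjoint f 1)"
    using assms by (auto simp: adjoint_works bounded_linear.linear)
  moreover have "(f has_derivative f) (at x)" using assms by (rule bounded_linear_imp_has_derivative)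
  ultimately show ?thesis unfolding gderiv_def by simp
qed

lemma real_polynomial_function_grad:
  fixes P :: "pt \<Rightarrow> real"
  assumes "real_polynomial_function P"
  shows "(\<forall>x. GDERIV P x :> grad P x) \<and> (\<forall>i. real_polynomial_function (\<lambda>x. grad P x $ i))"
proof -
  \<comment> \<open>The induction builds an explicit gradient \<open>D\<close>; that it equals
    \<open>grad P\<close> is concluded afterwards, from uniqueness.\<close>
  from assms have "\<exists>D. (\<forall>x. GDERIV P x :> D x) \<and> (\<forall>i. real_polynomial_function (\<lambda>x. D x $ i))"
  proof induction
    case (linear f)
    then show ?case using bounded_linear_GDERIV[OF linear] by (intro exI[of _ "\<lambda>_. adjoint f 1"]) auto
  next
    case (const c)
    then show ?case by (intro exI[of _ "\<lambda>_. 0"]) (auto simp: GDERIV_const)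
  next
    case (add f g)
    then obtain F G where "\<forall>x. GDERIV f x :> F x" "\<forall>i. real_polynomial_function (\<lambda>x. F x $ i)"
      "\<forall>x. GDERIV g x :> G x" "\<forall>i. real_polynomial_function (\<lambda>x. G x $ i)" by blast
    then show ?case by (intro exI[of _ "\<lambda>x. F x + G x"]) (auto intro: GDERIV_add)
  next
    case (mult f g)
    then obtain F G where "\<forall>x. GDERIV f x :> F x" "\<forall>i. real_polynomial_function (\<lambda>x. F x $ i)"
      "\<forall>x. GDERIV g x :> G x" "\<forall>i. real_polynomial_function (\<lambda>x. G x $ i)" by blast
    with mult.hyps show ?case
      by (intro exI[of _ "\<lambda>x. f x *\<^sub>R G x + g x *\<^sub>R F x"] conjI allI)
        (simp_all add: GDERIV_mult real_polynomial_function.intros)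
  qed
  then obtain D where D: "\<forall>x. GDERIV P x :> D x" "\<forall>i. real_polynomial_function (\<lambda>x. D x $ i)"
    by blast
  moreover from D have "grad P = D" by (auto intro: grad_eqI)
  ultimately show ?thesis by simp
qed

text \<open>The class of polynomials is closed under partial derivatives, so the induction on the
  order of differentiability can run over all polynomials at once.\<close>

lemma real_polynomial_function_smooth:
  assumes "real_polynomial_function P"
  shows "smooth P"
proof -
  have "C_n n P" if "real_polynomial_function P" for n P
    using that
  proof (induction n arbitrary: P)
    case 0
    then show ?case
      by (auto simp: continuous_on_polymonial_function simp flip: real_polynomial_function_eq)
  next
    case (Suc n)
    have "P differentiable at x" for x
      using real_polynomial_function_grad[OF Suc.prems] unfolding gderiv_def differentiable_def by blast
    then show ?case using Suc real_polynomial_function_grad[OF Suc.prems]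
      by (simp add: differentiable_on_def)
  qed
  with assms show ?thesis by (simp add: smooth_def)
qed

lemma continuous_on_vec_components:
  fixes F :: "pt \<Rightarrow> pt"
  assumes "\<And>i. continuous_on S (\<lambda>x. F x $ i)"
  shows "continuous_on S F"
  using continuous_on_vec_lambda[of S "\<lambda>i x. F x $ i", OF assms] by simp

lemma smooth_GDERIV: "smooth \<phi> \<Longrightarrow> GDERIV \<phi> x :> grad \<phi> x"
  unfolding smooth_def by (intro GDERIV_grad) (metis C_n.simps(2) differentiable_on_def UNIV_I)

lemma smooth_continuous: "smooth \<phi> \<Longrightarrow> continuous_on UNIV \<phi>"
  unfolding smooth_def by (metis C_n.simps(1))

lemma smooth_continuous_grad: "smooth \<phi> \<Longrightarrow> continuous_on UNIV (grad \<phi>)"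
  unfolding smooth_def
  by (intro continuous_on_vec_components) (metis C_n.simps)

section \<open>Polynomial spaces\<close>

lemma real_polynomial_function_component: "real_polynomial_function (\<lambda>x::pt. x $ i)"
  by (intro real_polynomial_function.intros(1) bounded_linear_vec_nth)

lemma real_polynomial_function_mono2: "real_polynomial_function (mono2 \<alpha>)"
  unfolding mono2_def[abs_def]
  by (intro real_polynomial_function.intros(4) real_polynomial_function_power
      real_polynomial_function_component)

text \<open>Membership in \<open>poly_space\<close> constrains a function on \<open>S\<close> only.
  Continuity and smoothness are therefore always taken from a global polynomial that agrees with it
  there.\<close>

lemma poly_space_eq_polynomial:
  assumes "r \<in> poly_space l S"
  obtains P where "real_polynomial_function P" "\<And>x. x \<in> S \<Longrightarrow> r x = P x"
proof -
  from assms obtain c where c: "\<And>x. x \<in> S \<Longrightarrow> r x = (\<Sum>\<alpha> | int (fst \<alpha> + snd \<alpha>) \<le> l. c \<alpha> * mono2 \<alpha> x)"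
    by (auto simp: poly_space_def)
  show thesis
    by (rule that[OF _ c])
      (intro real_polynomial_function_sum finite_bounded_pairs real_polynomial_function.intros(4)
        real_polynomial_function.intros(2) real_polynomial_function_mono2)
qed

lemma poly_fields_eq_polynomial:
  assumes "r \<in> poly_fields l S"
  obtains P :: "pt \<Rightarrow> pt" where "\<And>i. real_polynomial_function (\<lambda>x. P x $ i)" "\<And>x. x \<in> S \<Longrightarrow> r x = P x"
proof -
  have "\<forall>i. \<exists>P. real_polynomial_function P \<and> (\<forall>x\<in>S. r x $ i = P x)"
  proof
    fix i
    have "(\<lambda>x. r x $ i) \<in> poly_space l S" using assms by (simp add: poly_fields_def)
    then show "\<exists>P. real_polynomial_function P \<and> (\<forall>x\<in>S. r x $ i = P x)"
      by (rule poly_space_eq_polynomial) auto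
  qed
  then obtain P where P: "\<And>i. real_polynomial_function (P i)"
    and r: "\<And>i x. x \<in> S \<Longrightarrow> r x $ i = P i x"
    by metis
  show thesis
  proof (rule that)
    show "real_polynomial_function (\<lambda>x. (\<chi> j. P j x) $ i)" for i using P[of i] by simp
    show "r x = (\<chi> j. P j x)" if "x \<in> S" for x using r[OF that] by (simp add: vec_eq_iff)
  qed
qed

lemma poly_space_add: "r \<in> poly_space l S \<Longrightarrow> s \<in> poly_space l S \<Longrightarrow> (\<lambda>x. r x + s x) \<in> poly_space l S"
proof -
  assume "r \<in> poly_space l S" "s \<in> poly_space l S"
  then obtain c d where "\<forall>x\<in>S. r x = (\<Sum>\<alpha> | int (fst \<alpha> + snd \<alpha>) \<le> l. c \<alpha> * mono2 \<alpha> x)"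
    "\<forall>x\<in>S. s x = (\<Sum>\<alpha> | int (fst \<alpha> + snd \<alpha>) \<le> l. d \<alpha> * mono2 \<alpha> x)"
    unfolding poly_space_def by blast
  then show ?thesis unfolding poly_space_def
    by (auto intro!: exI[of _ "\<lambda>\<alpha>. c \<alpha> + d \<alpha>"] simp: sum.distrib distrib_right)
qed

lemma poly_space_uminus: "r \<in> poly_space l S \<Longrightarrow> (\<lambda>x. - r x) \<in> poly_space l S"
proof -
  assume "r \<in> poly_space l S"
  then obtain c where "\<forall>x\<in>S. r x = (\<Sum>\<alpha> | int (fst \<alpha> + snd \<alpha>) \<le> l. c \<alpha> * mono2 \<alpha> x)"
    unfolding poly_space_def by blast
  then show ?thesis unfolding poly_space_def
    by (auto intro!: exI[of _ "\<lambda>\<alpha>. - c \<alpha>"] simp: sum_negf)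
qed

lemma poly_fields_add: "r \<in> poly_fields l S \<Longrightarrow> s \<in> poly_fields l S \<Longrightarrow> (\<lambda>x. r x + s x) \<in> poly_fields l S"
  by (simp add: poly_fields_def poly_space_add)

lemma poly_fields_diff: "r \<in> poly_fields l S \<Longrightarrow> s \<in> poly_fields l S \<Longrightarrow> (\<lambda>x. r x - s x) \<in> poly_fields l S"
  unfolding poly_fields_def using poly_space_add poly_space_uminus by fastforce

section \<open>Integrability on bounded open sets\<close>

lemma finite_measure_lebesgue_on: "S \<in> lmeasurable \<Longrightarrow> finite_measure (lebesgue_on S)"
  by (rule finite_measureI) (auto simp: emeasure_restrict_space fmeasurable_def)

lemma lmeasurable_open_bounded:
  fixes E :: "'a::euclidean_space set"
  shows "open E \<Longrightarrow> bounded E \<Longrightarrow> E \<in> lmeasurable"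
  by (simp add: bounded_set_imp_lmeasurable borel_open)

lemma continuous_on_UNIV_bounded_image:
  fixes h :: "'a::heine_borel \<Rightarrow> 'b::metric_space"
  assumes "continuous_on UNIV h" "bounded E"
  shows "bounded (h ` E)"
proof -
  have "compact (h ` closure E)"
    using assms by (intro compact_continuous_image continuous_on_subset[OF assms(1)]) auto
  then show ?thesis by (meson bounded_subset compact_imp_bounded closure_subset image_mono)
qed

lemma continuous_on_UNIV_measurable_lebesgue_on:
  fixes h :: "'a::euclidean_space \<Rightarrow> 'b::euclidean_space"
  assumes "continuous_on UNIV h"
  shows "h \<in> borel_measurable (lebesgue_on E)"
proof -
  from assms have "h \<in> borel_measurable lborel" by (simp add: borel_measurable_continuous_onI)
  then show ?thesis by (intro measurable_restrict_space1 measurable_completion)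
qed

lemma integrable_inner_continuous:
  fixes u h :: "'a::euclidean_space \<Rightarrow> 'b::euclidean_space"
  assumes u: "integrable (lebesgue_on E) u" and h: "continuous_on UNIV h" and E: "bounded E"
  shows "integrable (lebesgue_on E) (\<lambda>x. u x \<bullet> h x)"
proof -
  obtain b where b: "\<And>x. x \<in> E \<Longrightarrow> norm (h x) \<le> b"
    using continuous_on_UNIV_bounded_image[OF h E] by (auto simp: bounded_iff)
  have "integrable (lebesgue_on E) (\<lambda>x. b * norm (u x))"
    using u by auto
  then show ?thesis
  proof (rule Bochner_Integration.integrable_bound)
    show "(\<lambda>x. u x \<bullet> h x) \<in> borel_measurable (lebesgue_on E)"
      using u continuous_on_UNIV_measurable_lebesgue_on[OF h, of E] by (intro borel_measurable_inner) auto
    have "\<bar>u x \<bullet> h x\<bar> \<le> norm (b * norm (u x))" if "x \<in> E" for x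
    proof -
      have "\<bar>u x \<bullet> h x\<bar> \<le> norm (u x) * norm (h x)" by (rule Cauchy_Schwarz_ineq2)
      also have "\<dots> \<le> norm (u x) * b" using b[OF that] by (intro mult_left_mono) auto
      finally show ?thesis by (simp add: mult.commute)
    qed
    then show "AE x in lebesgue_on E. norm (u x \<bullet> h x) \<le> norm (b * norm (u x))"
      by (intro AE_I2) simp
  qed
qed

lemma integrable_mult_continuous:
  fixes u h :: "pt \<Rightarrow> real"
  assumes "integrable (lebesgue_on E) u" "continuous_on UNIV h" "bounded E"
  shows "integrable (lebesgue_on E) (\<lambda>x. u x * h x)"
  using integrable_inner_continuous[OF assms] by (simp add: inner_real_def)

lemma integrable_continuous_lebesgue_on:
  fixes h :: "'a::euclidean_space \<Rightarrow> 'b::euclidean_space"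
  assumes h: "continuous_on UNIV h" and E: "open E" "bounded E"
  shows "integrable (lebesgue_on E) h"
proof -
  obtain b where b: "\<And>x. x \<in> E \<Longrightarrow> norm (h x) \<le> b"
    using continuous_on_UNIV_bounded_image[OF h E(2)] by (auto simp: bounded_iff)
  interpret finite_measure "lebesgue_on E"
    by (intro finite_measure_lebesgue_on lmeasurable_open_bounded E)
  show ?thesis
    by (rule integrable_const_bound[where B = b])
      (auto intro!: AE_I2 b continuous_on_UNIV_measurable_lebesgue_on h)
qed

lemma Lp_space_2_integrable:
  fixes v :: "pt \<Rightarrow> 'b::euclidean_space"
  assumes "v \<in> Lp_space 2 E" and E: "open E" "bounded E"
  shows "integrable (lebesgue_on E) v"
proof -
  interpret finite_measure "lebesgue_on E"
    by (intro finite_measure_lebesgue_on lmeasurable_open_bounded E)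
  from assms have v: "v \<in> borel_measurable (lebesgue_on E)"
    "integrable (lebesgue_on E) (\<lambda>x. norm (v x) powr 2)" by (auto simp: Lp_space_def)
  have "integrable (lebesgue_on E) (\<lambda>x. 1 + norm (v x) powr 2)" using v by simp
  then show ?thesis
  proof (rule Bochner_Integration.integrable_bound)
    have "norm (v x) \<le> 1 + norm (v x) powr 2" for x
    proof -
      \<comment> \<open>Expanding the square gives \<open>norm (v x)\<close> at most its square plus
        1/4; the constant is integrable because the measure is finite.\<close>
      have "0 \<le> (norm (v x) - 1 / 2)\<^sup>2" by simp
      then show ?thesis by (simp add: powr_numeral power2_eq_square algebra_simps)
    qed
    then show "AE x in lebesgue_on E. norm (v x) \<le> norm (1 + norm (v x) powr 2)"
      by (intro AE_I2) (smt (verit) real_norm_def)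
  qed (rule v)
qed

text \<open>Gram-Schmidt: the residual of \<open>b x\<close> against the earlier functions is either null or gives a new
  orthogonal direction.\<close>

lemma L2_projection_coefficients:
  fixes b :: "'i \<Rightarrow> pt \<Rightarrow> real"
  assumes E: "open E" "bounded E" and "finite A"
    and b: "\<And>a. a \<in> A \<Longrightarrow> continuous_on UNIV (b a)"
    and u: "integrable (lebesgue_on E) u"
  shows "\<exists>c. \<forall>a\<in>A. (LINT x|lebesgue_on E. (u x - (\<Sum>a\<in>A. c a * b a x)) * b a x) = 0"
  using \<open>finite A\<close> b u
proof (induction A arbitrary: u rule: finite_induct)
  case empty
  then show ?case by simp
next
  case (insert y A)
  let ?\<mu> = "lebesgue_on E"
  note prod = integrable_mult_continuous[OF _ _ E(2)]
  have bA: "continuous_on UNIV (b a)" if "a \<in> insert y A" for a using that insert.prems by auto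
  have comb: "continuous_on UNIV (\<lambda>x. \<Sum>a\<in>A. c a * b a x)" for c
    by (intro continuous_intros bA) auto
  have by_int: "integrable ?\<mu> (b y)"
    using bA by (intro integrable_continuous_lebesgue_on E) auto
  from insert.IH[OF bA by_int] obtain c where
    c: "\<forall>a\<in>A. (LINT x|?\<mu>. (b y x - (\<Sum>a\<in>A. c a * b a x)) * b a x) = 0" by auto
  from insert.IH[OF bA insert.prems(2)] obtain d where
    d: "\<forall>a\<in>A. (LINT x|?\<mu>. (u x - (\<Sum>a\<in>A. d a * b a x)) * b a x) = 0" by auto
  define r where "r = (\<lambda>x. b y x - (\<Sum>a\<in>A. c a * b a x))"
  define u' where "u' = (\<lambda>x. u x - (\<Sum>a\<in>A. d a * b a x))"
  have r_cont: "continuous_on UNIV r" unfolding r_def by (intro continuous_intros comb bA) auto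
  have r_int: "integrable ?\<mu> r" by (intro integrable_continuous_lebesgue_on E r_cont)
  have u'_int: "integrable ?\<mu> u'" unfolding u'_def
    by (intro Bochner_Integration.integrable_diff insert.prems integrable_continuous_lebesgue_on E comb)
  \<comment> \<open>For a function orthogonal to the earlier ones, testing with \<open>b y\<close>
    is the same as testing with its residual \<open>r\<close>.\<close>
  have orth_y: "(LINT x|?\<mu>. w x * b y x) = (LINT x|?\<mu>. w x * r x)"
    if w: "integrable ?\<mu> w" and 0: "\<forall>a\<in>A. (LINT x|?\<mu>. w x * b a x) = 0" for w
  proof -
    have "(LINT x|?\<mu>. w x * b y x) = (LINT x|?\<mu>. w x * r x + (\<Sum>a\<in>A. c a * (w x * b a x)))"
      by (simp add: r_def algebra_simps sum_distrib_left)
    also have "\<dots> = (LINT x|?\<mu>. w x * r x) + (LINT x|?\<mu>. (\<Sum>a\<in>A. c a * (w x * b a x)))"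
      by (intro Bochner_Integration.integral_add Bochner_Integration.integrable_sum
          integrable_mult_right prod w r_cont bA) auto
    also have "(LINT x|?\<mu>. (\<Sum>a\<in>A. c a * (w x * b a x))) =
        (\<Sum>a\<in>A. (LINT x|?\<mu>. c a * (w x * b a x)))"
      by (intro Bochner_Integration.integral_sum integrable_mult_right prod w bA) auto
    also have "\<dots> = (\<Sum>a\<in>A. c a * (LINT x|?\<mu>. w x * b a x))" by simp
    also have "(LINT x|?\<mu>. w x * r x) + \<dots> = (LINT x|?\<mu>. w x * r x)" using 0 by simp
    finally show ?thesis .
  qed
  \<comment> \<open>If \<open>r\<close> is null, division by zero makes \<open>t\<close> equal to 0;
    any value would do then, since all integrals against \<open>r\<close> vanish.\<close>
  define t where "t = (LINT x|?\<mu>. u' x * r x) / (LINT x|?\<mu>. r x * r x)"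
  define w where "w = (\<lambda>x. u' x - t * r x)"
  have w_int: "integrable ?\<mu> w" unfolding w_def
    by (intro Bochner_Integration.integrable_diff u'_int integrable_mult_right r_int)
  have split: "(LINT x|?\<mu>. w x * h x) = (LINT x|?\<mu>. u' x * h x) - t * (LINT x|?\<mu>. r x * h x)"
    if "continuous_on UNIV h" for h
  proof -
    have "(LINT x|?\<mu>. w x * h x) = (LINT x|?\<mu>. u' x * h x - t * (r x * h x))"
      by (simp add: w_def algebra_simps)
    also have "\<dots> = (LINT x|?\<mu>. u' x * h x) - t * (LINT x|?\<mu>. r x * h x)"
      using that u'_int r_int prod by (subst Bochner_Integration.integral_diff) auto
    finally show ?thesis .
  qed
  have wA: "\<forall>a\<in>A. (LINT x|?\<mu>. w x * b a x) = 0"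
    using c d bA by (auto simp: split r_def u'_def)
  have wr: "(LINT x|?\<mu>. w x * r x) = 0"
  proof (cases "(LINT x|?\<mu>. r x * r x) = 0")
    case False
    then show ?thesis by (simp add: split r_cont t_def)
  next
    case True
    then have "AE x in ?\<mu>. r x * r x = 0"
      using integral_nonneg_eq_0_iff_AE[OF prod[OF r_int r_cont]] by simp
    then have "AE x in ?\<mu>. w x * r x = 0" by eventually_elim simp
    then show ?thesis by (rule integral_eq_zero_AE)
  qed
  let ?c = "\<lambda>a. if a = y then t else d a - t * c a"
  have "(\<Sum>a\<in>insert y A. ?c a * b a x) = (\<Sum>a\<in>A. d a * b a x) + t * r x" for x
  proof -
    have "(\<Sum>a\<in>A. ?c a * b a x) = (\<Sum>a\<in>A. (d a - t * c a) * b a x)"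
      using insert.hyps by (intro sum.cong) auto
    then show ?thesis using insert.hyps
      by (simp add: r_def algebra_simps sum_subtractf sum_distrib_left)
  qed
  then have "w = (\<lambda>x. u x - (\<Sum>a\<in>insert y A. ?c a * b a x))"
    by (auto simp: w_def u'_def)
  moreover have "\<forall>a\<in>insert y A. (LINT x|?\<mu>. w x * b a x) = 0"
    using wA wr orth_y[OF w_int wA] by simp
  ultimately show ?case by (intro exI[of _ ?c]) simp
qed

section \<open>The L2 projection is well defined and additive\<close>

text \<open>A witness must be produced before the \<open>SOME\<close> in \<open>L2_proj\<close> can
  be used. The components of a test field are independent of each other, so the projection is found
  for each component of \<open>v\<close> separately, against the monomials of degree at most
  \<open>k\<close>.\<close>

lemma L2_proj_properties:
  assumes E: "open E" "bounded E" and v: "integrable (lebesgue_on E) v"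
  shows "L2_proj k E v \<in> poly_fields (int k) E"
    and "r \<in> poly_fields (int k) E \<Longrightarrow> (LINT x|lebesgue_on E. (v x - L2_proj k E v x) \<bullet> r x) = 0"
proof -
  let ?\<mu> = "lebesgue_on E"
  let ?A = "{\<alpha>. int (fst \<alpha> + snd \<alpha>) \<le> int k}"
  have mono: "continuous_on UNIV (mono2 \<alpha>)" for \<alpha>
    by (intro smooth_continuous real_polynomial_function_smooth real_polynomial_function_mono2)
  have v_i: "integrable ?\<mu> (\<lambda>x. v x $ i)" for i
    using integrable_inner_continuous[OF v continuous_on_const E(2), of "axis i 1"]
    by (simp add: cart_eq_inner_axis)
  have "\<forall>i. \<exists>c. \<forall>\<alpha>\<in>?A. (LINT x|?\<mu>. (v x $ i - (\<Sum>\<alpha>\<in>?A. c \<alpha> * mono2 \<alpha> x)) * mono2 \<alpha> x) = 0"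
    by (intro allI L2_projection_coefficients E finite_bounded_pairs mono v_i)
  from choice[OF this] obtain c where
    c: "\<And>i \<alpha>. \<alpha> \<in> ?A \<Longrightarrow> (LINT x|?\<mu>. (v x $ i - (\<Sum>\<alpha>\<in>?A. c i \<alpha> * mono2 \<alpha> x)) * mono2 \<alpha> x) = 0"
    by blast
  define q where "q = (\<lambda>x. (\<chi> i. \<Sum>\<alpha>\<in>?A. c i \<alpha> * mono2 \<alpha> x) :: pt)"
  have q_poly: "q \<in> poly_fields (int k) E" by (auto simp: poly_fields_def poly_space_def q_def)
  have q_int: "integrable ?\<mu> (\<lambda>x. v x $ i - q x $ i)" for i
    unfolding q_def
    by (intro Bochner_Integration.integrable_diff v_i integrable_continuous_lebesgue_on E)
      (simp, intro continuous_intros mono)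
  have q_orth: "(LINT x|?\<mu>. (v x - q x) \<bullet> r x) = 0" if "r \<in> poly_fields (int k) E" for r
  proof -
    have "\<forall>i. \<exists>d. \<forall>x\<in>E. r x $ i = (\<Sum>\<alpha>\<in>?A. d \<alpha> * mono2 \<alpha> x)"
      using that by (simp add: poly_fields_def poly_space_def)
    from choice[OF this] obtain d where
      d: "\<And>i x. x \<in> E \<Longrightarrow> r x $ i = (\<Sum>\<alpha>\<in>?A. d i \<alpha> * mono2 \<alpha> x)" by blast
    have "(LINT x|?\<mu>. (v x - q x) \<bullet> r x) =
        (LINT x|?\<mu>. (\<Sum>i\<in>UNIV. \<Sum>\<alpha>\<in>?A. d i \<alpha> * ((v x $ i - q x $ i) * mono2 \<alpha> x)))"
      by (intro Bochner_Integration.integral_cong refl)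
        (simp add: inner_vec_def d sum_distrib_left mult_ac)
    also have "\<dots> = (\<Sum>i\<in>UNIV. (LINT x|?\<mu>. (\<Sum>\<alpha>\<in>?A. d i \<alpha> * ((v x $ i - q x $ i) * mono2 \<alpha> x))))"
      by (intro Bochner_Integration.integral_sum Bochner_Integration.integrable_sum
          integrable_mult_right integrable_mult_continuous q_int mono E)
    also have "\<dots> = (\<Sum>i\<in>UNIV. \<Sum>\<alpha>\<in>?A. (LINT x|?\<mu>. d i \<alpha> * ((v x $ i - q x $ i) * mono2 \<alpha> x)))"
      by (intro sum.cong refl Bochner_Integration.integral_sum
          integrable_mult_right integrable_mult_continuous q_int mono E)
    also have "\<dots> = (\<Sum>i\<in>UNIV. \<Sum>\<alpha>\<in>?A. d i \<alpha> * (LINT x|?\<mu>. (v x $ i - q x $ i) * mono2 \<alpha> x))"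
      by simp
    also have "\<dots> = 0" using c by (simp add: q_def)
    finally show ?thesis .
  qed
  have "\<exists>q. q \<in> poly_fields (int k) E \<and> (\<forall>r\<in>poly_fields (int k) E. (LINT x|?\<mu>. (v x - q x) \<bullet> r x) = 0)"
    using q_poly q_orth by blast
  from someI_ex[OF this, folded L2_proj_def]
  show "L2_proj k E v \<in> poly_fields (int k) E"
    and "r \<in> poly_fields (int k) E \<Longrightarrow> (LINT x|?\<mu>. (v x - L2_proj k E v x) \<bullet> r x) = 0"
    by auto
qed

lemma poly_fields_integrable_inner:
  assumes E: "open E" "bounded E" and u: "integrable (lebesgue_on E) u"
    and r: "r \<in> poly_fields l E"
  shows "integrable (lebesgue_on E) (\<lambda>x. u x \<bullet> r x)"
proof -
  obtain P where P: "\<And>i. real_polynomial_function (\<lambda>x. P x $ i)" "\<And>x. x \<in> E \<Longrightarrow> r x = P x"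
    using poly_fields_eq_polynomial[OF r] by metis
  have "continuous_on UNIV P"
    using P(1) by (intro continuous_on_vec_components smooth_continuous real_polynomial_function_smooth)
  then have "integrable (lebesgue_on E) (\<lambda>x. u x \<bullet> P x)"
    by (rule integrable_inner_continuous[OF u _ E(2)])
  then show ?thesis by (subst Bochner_Integration.integrable_cong[OF refl]) (auto simp: P(2))
qed

lemma poly_fields_integrable:
  assumes E: "open E" "bounded E" and r: "r \<in> poly_fields l E"
  shows "integrable (lebesgue_on E) r" "bounded (r ` E)"
proof -
  obtain P where P: "\<And>i. real_polynomial_function (\<lambda>x. P x $ i)" "\<And>x. x \<in> E \<Longrightarrow> r x = P x"
    using poly_fields_eq_polynomial[OF r] by metis
  have cont: "continuous_on UNIV P"
    using P(1) by (intro continuous_on_vec_components smooth_continuous real_polynomial_function_smooth)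
  show "integrable (lebesgue_on E) r"
    using integrable_continuous_lebesgue_on[OF cont E]
    by (subst Bochner_Integration.integrable_cong[OF refl]) (auto simp: P(2))
  have "r ` E = P ` E" using P(2) by auto
  then show "bounded (r ` E)" using continuous_on_UNIV_bounded_image[OF cont E(2)] by simp
qed

text \<open>The set where \<open>g\<close> is nonzero is open and negligible, hence empty. This
  turns almost everywhere equality of polynomial fields into equality at every point of
  \<open>E\<close>.\<close>

lemma continuous_AE_zero_on_open:
  fixes g :: "'a::euclidean_space \<Rightarrow> real"
  assumes E: "open E" and g: "continuous_on E g" and ae: "AE x in lebesgue_on E. g x = 0"
    and x: "x \<in> E"
  shows "g x = 0"
proof -
  have "open (E \<inter> g -` (- {0}))"
    using continuous_open_preimage[OF g E] by auto
  moreover have "negligible (E \<inter> g -` (- {0}))"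
  proof -
    have "E \<in> sets lebesgue" using E by (simp add: borel_open)
    then have "AE x in lebesgue. x \<in> E \<longrightarrow> g x = 0"
      using ae by (simp add: AE_restrict_space_iff)
    then have "AE x in lebesgue. x \<notin> E \<inter> g -` (- {0})" by eventually_elim auto
    moreover have "E \<inter> g -` (- {0}) \<in> sets lebesgue"
      using \<open>open (E \<inter> g -` (- {0}))\<close> by (simp add: borel_open)
    ultimately have "E \<inter> g -` (- {0}) \<in> null_sets lebesgue" by (simp add: AE_iff_null_sets)
    then show ?thesis by (simp add: negligible_iff_null_sets)
  qed
  ultimately have "E \<inter> g -` (- {0}) = {}" using open_not_negligible by blast
  with x show ?thesis by auto
qed

text \<open>The difference of two candidates is itself an admissible test field; inserting it into
  both orthogonality relations makes its L2 norm zero.\<close>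

lemma L2_proj_eqI:
  assumes E: "open E" "bounded E" and v: "integrable (lebesgue_on E) v"
    and q: "q \<in> poly_fields (int k) E"
    and orth: "\<And>r. r \<in> poly_fields (int k) E \<Longrightarrow> (LINT x|lebesgue_on E. (v x - q x) \<bullet> r x) = 0"
    and x: "x \<in> E"
  shows "L2_proj k E v x = q x"
proof -
  let ?\<mu> = "lebesgue_on E"
  let ?p = "L2_proj k E v"
  note p = L2_proj_properties[OF E v]
  define d where "d = (\<lambda>x. q x - ?p x)"
  have d: "d \<in> poly_fields (int k) E" unfolding d_def by (intro poly_fields_diff q p(1))
  note int = poly_fields_integrable_inner[OF E _ d]
  have "(LINT x|?\<mu>. d x \<bullet> d x) = (LINT x|?\<mu>. (v x - ?p x) \<bullet> d x - (v x - q x) \<bullet> d x)"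
    by (simp add: d_def algebra_simps)
  also have "\<dots> = 0"
    using orth[OF d] p(2)[OF d]
    by (subst Bochner_Integration.integral_diff)
      (auto intro!: int Bochner_Integration.integrable_diff v poly_fields_integrable(1)[OF E q]
          poly_fields_integrable(1)[OF E p(1)])
  finally have "AE x in ?\<mu>. d x \<bullet> d x = 0"
    using integral_nonneg_eq_0_iff_AE[OF int[OF poly_fields_integrable(1)[OF E d]]] by simp
  moreover obtain P where P: "\<And>i. real_polynomial_function (\<lambda>x. P x $ i)" "\<And>x. x \<in> E \<Longrightarrow> d x = P x"
    using poly_fields_eq_polynomial[OF d] by metis
  have "continuous_on UNIV P"
    using P(1) by (intro continuous_on_vec_components smooth_continuous real_polynomial_function_smooth)
  then have "continuous_on E (\<lambda>x. P x \<bullet> P x)"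
    by (intro continuous_intros) (auto intro: continuous_on_subset)
  then have "continuous_on E (\<lambda>x. d x \<bullet> d x)"
    using P(2) by (simp cong: continuous_on_cong)
  ultimately have "d x \<bullet> d x = 0" using continuous_AE_zero_on_open[OF E(1) _ _ x] by blast
  then show ?thesis by (simp add: d_def)
qed

lemma L2_proj_add:
  assumes E: "open E" "bounded E" and v: "integrable (lebesgue_on E) v" and w: "integrable (lebesgue_on E) w"
    and x: "x \<in> E"
  shows "L2_proj k E (\<lambda>x. v x + w x) x = L2_proj k E v x + L2_proj k E w x"
proof (rule L2_proj_eqI[OF E _ _ _ x])
  note pv = L2_proj_properties[OF E v] and pw = L2_proj_properties[OF E w]
  show "(\<lambda>x. L2_proj k E v x + L2_proj k E w x) \<in> poly_fields (int k) E"
    by (intro poly_fields_add pv pw)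
  fix r assume r: "r \<in> poly_fields (int k) E"
  note int = poly_fields_integrable_inner[OF E _ r]
  have "(LINT x|lebesgue_on E. (v x + w x - (L2_proj k E v x + L2_proj k E w x)) \<bullet> r x) =
    (LINT x|lebesgue_on E. (v x - L2_proj k E v x) \<bullet> r x + (w x - L2_proj k E w x) \<bullet> r x)"
    by (simp add: algebra_simps)
  also have "\<dots> = 0"
    using pv(2)[OF r] pw(2)[OF r]
    by (subst Bochner_Integration.integral_add)
      (auto intro!: int Bochner_Integration.integrable_diff v w
          poly_fields_integrable(1)[OF E pv(1)] poly_fields_integrable(1)[OF E pw(1)])
  finally show "(LINT x|lebesgue_on E. (v x + w x - (L2_proj k E v x + L2_proj k E w x)) \<bullet> r x) = 0" .
qed (use v w in auto)


section \<open>Green's formula on polygons\<close>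

text \<open>The truncation to \<open>[-1, 1]\<close> keeps the function bounded where the limit fails to exist and \<open>lim\<close> is
  arbitrary.\<close>

definition jump :: "(real \<Rightarrow> real) \<Rightarrow> real \<Rightarrow> real" where
  "jump u z = max (- 1) (min 1 (lim (\<lambda>n. u (z - 1 / Suc n) - u (z + 1 / Suc n))))"

lemma jump_eq:
  assumes "a < z" "z < b"
    and left: "\<And>x. a \<le> x \<Longrightarrow> x < z \<Longrightarrow> u x = u a"
    and right: "\<And>x. z < x \<Longrightarrow> x \<le> b \<Longrightarrow> u x = u b"
    and range: "\<And>x. 0 \<le> u x \<and> u x \<le> 1"
  shows "jump u z = u a - u b"
proof -
  let ?\<delta> = "min (z - a) (b - z)"
  have "(\<lambda>n. 1 / real (Suc n)) \<longlonglongrightarrow> 0" using LIMSEQ_inverse_real_of_nat by (simp add: inverse_eq_divide)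
  moreover have "?\<delta> > 0" using assms by simp
  ultimately have "\<forall>\<^sub>F n in sequentially. 1 / real (Suc n) < ?\<delta>"
    by (rule order_tendstoD(2))
  then have "\<forall>\<^sub>F n in sequentially. u (z - 1 / Suc n) - u (z + 1 / Suc n) = u a - u b"
  proof eventually_elim
    case (elim n)
    then show ?case using left[of "z - 1 / Suc n"] right[of "z + 1 / Suc n"] by simp
  qed
  then have "(\<lambda>n. u (z - 1 / Suc n) - u (z + 1 / Suc n)) \<longlonglongrightarrow> u a - u b"
    by (rule tendsto_eventually)
  then have "lim (\<lambda>n. u (z - 1 / Suc n) - u (z + 1 / Suc n)) = u a - u b" by (rule limI)
  \<comment> \<open>Values of \<open>u\<close> between 0 and 1 have differences in
    \<open>[-1, 1]\<close>, where the truncation is inactive.\<close>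
  then show ?thesis using range[of a] range[of b] unfolding jump_def by simp
qed

text \<open>The fundamental theorem on each piece, followed by summation by parts: at an exceptional
  point \<open>z\<close> the two neighbouring pieces contribute the left value minus the right value
  of \<open>u\<close>, times \<open>F z\<close>. The induction removes the smallest exceptional
  point. \<open>S\<close> may contain points at which \<open>u\<close> does not jump, and
  \<open>u\<close> is unrestricted on \<open>S\<close> apart from its range.\<close>

lemma piecewise_constant_has_integral:
  fixes u F F' :: "real \<Rightarrow> real"
  assumes S: "finite S" and F: "\<And>x. (F has_real_derivative F' x) (at x)"
    and const: "\<And>a b. a \<le> b \<Longrightarrow> {a..b} \<inter> S = {} \<Longrightarrow> u a = u b"
    and range: "\<And>x. 0 \<le> u x \<and> u x \<le> 1"
    and "a \<le> b" "a \<notin> S" "b \<notin> S"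
  shows "((\<lambda>x. u x * F' x) has_integral
            (u b * F b - u a * F a + (\<Sum>z\<in>S \<inter> {a..b}. jump u z * F z))) {a..b}"
  using assms(5-)
proof (induction "card (S \<inter> {a..b})" arbitrary: a rule: less_induct)
  case (less a)
  have FTC: "(F' has_integral F d - F c) {c..d}" if "c \<le> d" for c d
    using that F by (intro fundamental_theorem_of_calculus)
      (auto simp: has_real_derivative_iff_has_vector_derivative[symmetric] intro: DERIV_subset)
  show ?case
  proof (cases "S \<inter> {a..b} = {}")
    case True
    have "u x = u a" if "x \<in> {a..b}" for x
      using True that by (intro const[symmetric]) auto
    then have eq: "u a * F' x = u x * F' x" if "x \<in> {a..b}" for x
      using that by metis
    have "((\<lambda>x. u a * F' x) has_integral u a * (F b - F a)) {a..b}"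
      by (intro has_integral_mult_right FTC less.prems)
    then have "((\<lambda>x. u x * F' x) has_integral u a * (F b - F a)) {a..b}"
      by (rule has_integral_eq[rotated]) (use eq in auto)
    moreover have "u b = u a" using True less.prems by (intro const[symmetric]) auto
    ultimately show ?thesis using True by (simp add: algebra_simps)
  next
    case False
    define z where "z = Min (S \<inter> {a..b})"
    have fin: "finite (S \<inter> {a..b})" using S by simp
    have z: "z \<in> S" "a < z" "z < b"
      using Min_in[OF fin False] less.prems unfolding z_def[symmetric]
      by (auto simp: less_le)
    have z_le: "z \<le> x" if "x \<in> S" "a \<le> x" "x \<le> b" for x
      using that fin unfolding z_def by (intro Min_le) auto
    define T where "T = S \<inter> {z<..b}"
    have finT: "finite T" using S by (simp add: T_def)
    \<comment> \<open>A cut between the first exceptional point and the next one, or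
      \<open>b\<close> if there is no next one. It must not be exceptional itself, so that the
      induction hypothesis applies on \<open>{c..b}\<close>.\<close>
    obtain c where c: "z < c" "c \<le> b" "c \<notin> S" "S \<inter> {a..c} = {z}" "S \<inter> {c..b} = T"
    proof (cases "T = {}")
      case True
      have "S \<inter> {a..b} = {z}" using True z z_le by (force simp: T_def)
      moreover have "S \<inter> {b..b} = T" using True less.prems by auto
      ultimately show thesis using z less.prems by (intro that[of b]) auto
    next
      case False
      define c where "c = (z + Min T) / 2"
      have m: "Min T \<in> S" "z < Min T" "Min T \<le> b" using Min_in[OF finT False] by (auto simp: T_def)
      have T_ge: "Min T \<le> x" if "x \<in> S" "z < x" "x \<le> b" for x
        using that finT by (intro Min_le) (auto simp: T_def)
      have c1: "z < c" "c < Min T" using m by (auto simp: c_def)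
      have c2: "c \<notin> S" using T_ge[of c] c1 m by auto
      show thesis
      proof (rule that)
        have "S \<inter> {a..c} \<subseteq> {z}"
        proof
          fix x assume x: "x \<in> S \<inter> {a..c}"
          then have "\<not> z < x" using T_ge[of x] c1 m by auto
          moreover have "z \<le> x" using x z_le[of x] c1 m by auto
          ultimately show "x \<in> {z}" by simp
        qed
        moreover have "z \<in> S \<inter> {a..c}" using z c1 by simp
        ultimately show "S \<inter> {a..c} = {z}" by blast
        show "S \<inter> {c..b} = T"
        proof (rule set_eqI)
          show "x \<in> S \<inter> {c..b} \<longleftrightarrow> x \<in> T" for x using T_ge[of x] c1 unfolding T_def by auto
        qed
      qed (use c1 c2 m in auto)
    qed
    have const_left: "u x = u a" if "a \<le> x" "x < z" for x
    proof -
      have "y \<notin> S" if "y \<in> {a..x}" for y using z_le[of y] that \<open>x < z\<close> z by auto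
      then have "{a..x} \<inter> S = {}" by blast
      then show ?thesis using const that by metis
    qed
    have const_right: "u x = u c" if "z < x" "x \<le> c" for x
    proof -
      have "S \<inter> {x..c} \<subseteq> S \<inter> {a..c} - {z}" using that z by auto
      then have "{x..c} \<inter> S = {}" using c by auto
      then show ?thesis using const that by metis
    qed
    \<comment> \<open>The value of \<open>u\<close> at \<open>z\<close> itself need not equal
      \<open>u a\<close>; a single point does not change the integral.\<close>
    have "((\<lambda>x. u x * F' x) has_integral u a * (F z - F a)) {a..z}"
    proof (rule has_integral_spike_finite)
      show "((\<lambda>x. u a * F' x) has_integral u a * (F z - F a)) {a..z}"
        using z by (intro has_integral_mult_right FTC) auto
      show "u x * F' x = u a * F' x" if "x \<in> {a..z} - {z}" for x
        using const_left[of x] that by simp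
    qed simp
    moreover have "((\<lambda>x. u x * F' x) has_integral u c * (F c - F z)) {z..c}"
    proof (rule has_integral_spike_finite)
      show "((\<lambda>x. u c * F' x) has_integral u c * (F c - F z)) {z..c}"
        using c by (intro has_integral_mult_right FTC) auto
      show "u x * F' x = u c * F' x" if "x \<in> {z..c} - {z}" for x
        using const_right[of x] that by simp
    qed simp
    moreover have "((\<lambda>x. u x * F' x) has_integral
        (u b * F b - u c * F c + (\<Sum>z\<in>S \<inter> {c..b}. jump u z * F z))) {c..b}"
    proof (rule less.hyps)
      have "T \<subset> S \<inter> {a..b}" using z by (auto simp: T_def)
      then show "card (S \<inter> {c..b}) < card (S \<inter> {a..b})"
        unfolding c(5) using fin by (rule psubset_card_mono[rotated])
    qed (use c less.prems in auto)
    ultimately have I: "((\<lambda>x. u x * F' x) has_integral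
        (u a * (F z - F a) + u c * (F c - F z) +
         (u b * F b - u c * F c + (\<Sum>z\<in>S \<inter> {c..b}. jump u z * F z)))) {a..b}"
      using z c by (intro has_integral_combine[of a c b] has_integral_combine[of a z c]) auto
    have "S \<inter> {a..b} = insert z T"
      using z z_le by (auto simp: T_def less_le)
    then have sum: "(\<Sum>x\<in>S \<inter> {a..b}. jump u x * F x) = jump u z * F z + (\<Sum>x\<in>T. jump u x * F x)"
      using finT by (simp add: T_def)
    have jump: "jump u z = u a - u c"
      by (rule jump_eq[OF \<open>a < z\<close> \<open>z < c\<close> const_left const_right range])
    show ?thesis using I unfolding sum jump c(5) by (simp add: algebra_simps)
  qed
qed

text \<open>By connectedness an interval that misses the frontier lies inside \<open>U\<close> or
  outside it, so the indicator is constant on intervals disjoint from \<open>S\<close>.\<close>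

lemma integral_indicator_finite_frontier:
  fixes F F' :: "real \<Rightarrow> real"
  assumes U: "open U" "bounded U" and S: "finite S" "frontier U \<subseteq> S"
    and F: "\<And>x. (F has_real_derivative F' x) (at x)" and F': "continuous_on UNIV F'"
  shows "(LINT x|lborel. indicator U x * F' x) = (\<Sum>z\<in>S. jump (indicator U) z * F z)"
proof -
  have "bounded (U \<union> S)" using U S finite_imp_bounded by simp
  then obtain r where r: "\<And>x. x \<in> U \<union> S \<Longrightarrow> \<bar>x\<bar> \<le> r" by (auto simp: bounded_iff)
  \<comment> \<open>Beyond all of \<open>U\<close> and \<open>S\<close>: the boundary terms of the
    integral vanish and no point of \<open>S\<close> is lost.\<close>
  define b where "b = \<bar>r\<bar> + 1"
  have b: "-b < x \<and> x < b" if "x \<in> U \<union> S" for x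
    using r[OF that] unfolding b_def by linarith
  have const: "indicat_real U x = indicator U y" if "x \<le> y" "{x..y} \<inter> S = {}" for x y
  proof (rule ccontr)
    assume "indicat_real U x \<noteq> indicator U y"
    then have "x \<in> U \<longleftrightarrow> y \<notin> U" by (auto simp: indicator_def split: if_splits)
    moreover have "x \<in> {x..y}" "y \<in> {x..y}" using that by auto
    ultimately have "{x..y} \<inter> U \<noteq> {}" "{x..y} - U \<noteq> {}" by blast+
    then have "{x..y} \<inter> frontier U \<noteq> {}" by (intro connected_Int_frontier) auto
    with that S show False by auto
  qed
  have out: "indicat_real U b = 0" "indicat_real U (- b) = 0" "b \<notin> S" "- b \<notin> S" using b[of b] b[of "-b"]
    by (auto simp: indicator_def)
  have "((\<lambda>x. indicat_real U x * F' x) has_integral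
      (indicator U b * F b - indicator U (-b) * F (-b) + (\<Sum>z\<in>S \<inter> {-b..b}. jump (indicator U) z * F z))) {-b..b}"
    by (intro piecewise_constant_has_integral S F const out) (auto simp: indicator_def b_def)
  moreover have "S \<inter> {-b..b} = S" using b by force
  ultimately have "((\<lambda>x. indicat_real U x * F' x) has_integral (\<Sum>z\<in>S. jump (indicator U) z * F z)) {-b..b}"
    using out by simp
  then have "((\<lambda>x. indicat_real U x * F' x) has_integral (\<Sum>z\<in>S. jump (indicator U) z * F z)) UNIV"
  proof (rule has_integral_on_superset)
    show "indicat_real U x * F' x = 0" if "x \<notin> {-b..b}" for x
      using that b[of x] by (auto simp: indicator_def)
  qed auto
  moreover have "integrable lborel (\<lambda>x. indicat_real U x * F' x)"
  proof -
    have "set_integrable lborel {-b..b} F'"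
      by (intro borel_integrable_atLeastAtMost' continuous_on_subset[OF F']) auto
    moreover have "U \<subseteq> {-b..b}" using b by force
    ultimately have "set_integrable lborel U F'"
      using U by (intro set_integrable_subset[of _ "{-b..b}" F' U]) auto
    then show ?thesis by (simp add: set_integrable_def)
  qed
  then have "((\<lambda>x. indicat_real U x * F' x) has_integral (LINT x|lborel. indicat_real U x * F' x)) UNIV"
    by (rule has_integral_integral_lborel)
  ultimately show ?thesis by (rule has_integral_unique[rotated])
qed

section \<open>Fubini's theorem along coordinate lines\<close>

text \<open>One map for both directions, so that slicing along either axis is treated once.\<close>

definition pt_of :: "2 \<Rightarrow> real \<Rightarrow> real \<Rightarrow> pt" where
  "pt_of i x y = (\<chi> k. if k = i then x else y)"

lemma pt_of_continuous: "continuous_on UNIV (\<lambda>z. pt_of i (fst z) (snd z))"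
proof -
  have "continuous_on UNIV (\<lambda>z::real \<times> real. if k = i then fst z else snd z)" for k
    by (cases "k = i") (simp_all add: continuous_on_fst continuous_on_snd continuous_on_id)
  then show ?thesis unfolding pt_of_def by (rule continuous_on_vec_lambda)
qed

lemma UNIV_2_distinct:
  fixes i j :: 2
  assumes "i \<noteq> j"
  shows "UNIV = {i, j}"
  using exhaust_2[of i] exhaust_2[of j] assms by (auto simp: UNIV_2)

lemma pt_of_nth: "i \<noteq> j \<Longrightarrow> pt_of i x y $ i = x" "i \<noteq> j \<Longrightarrow> pt_of i x y $ j = y"
  by (auto simp: pt_of_def)

lemma pt_of_component: "i \<noteq> j \<Longrightarrow> pt_of i (z $ i) (z $ j) = z"
proof -
  assume ij: "i \<noteq> j"
  have "pt_of i (z $ i) (z $ j) $ k = z $ k" for k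
    using UNIV_2_distinct[OF ij] UNIV_I[of k] by (auto simp: pt_of_def)
  then show ?thesis by (simp add: vec_eq_iff)
qed

text \<open>Lebesgue measure is determined by its values on boxes, and the preimage of a box is a
  product of two intervals. This transports Fubini's theorem from pairs of reals to the vector
  type.\<close>

lemma lborel_eq_distr_pt_of:
  "distr (lborel \<Otimes>\<^sub>M lborel) borel (\<lambda>z. pt_of i (fst z) (snd z)) = lborel"
proof -
  obtain j :: 2 where ij: "i \<noteq> j" by (cases "i = 1") (use that[of 1] that[of 2] in auto)
  have m: "(\<lambda>z. pt_of i (fst z) (snd z)) \<in> (lborel \<Otimes>\<^sub>M lborel) \<rightarrow>\<^sub>M borel"
    using borel_measurable_continuous_onI[OF pt_of_continuous] by (simp add: lborel_prod)
  show ?thesis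
  proof (rule lborel_eqI[symmetric])
    fix l u :: pt assume lu: "\<And>b. b \<in> Basis \<Longrightarrow> l \<bullet> b \<le> u \<bullet> b"
    have le: "l $ k \<le> u $ k" for k
      using lu[of "axis k 1"] by (simp add: cart_eq_inner_axis[symmetric] axis_in_Basis_iff)
    have "(\<lambda>z. pt_of i (fst z) (snd z)) -` box l u = {l $ i<..<u $ i} \<times> {l $ j<..<u $ j}"
    proof -
      have "(\<forall>k. l $ k < pt_of i x y $ k \<and> pt_of i x y $ k < u $ k) \<longleftrightarrow>
          (\<forall>k\<in>{i, j}. l $ k < pt_of i x y $ k \<and> pt_of i x y $ k < u $ k)" for x y
        unfolding UNIV_2_distinct[OF ij, symmetric] by simp
      then show ?thesis using ij by (auto simp: mem_box_cart pt_of_nth)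
    qed
    then have "emeasure (distr (lborel \<Otimes>\<^sub>M lborel) borel (\<lambda>z. pt_of i (fst z) (snd z))) (box l u)
        = emeasure (lborel \<Otimes>\<^sub>M lborel) ({l $ i<..<u $ i} \<times> {l $ j<..<u $ j})"
      by (subst emeasure_distr[OF m]) (auto simp: space_pair_measure)
    also have "\<dots> = ennreal ((u $ i - l $ i) * (u $ j - l $ j))"
      using le by (subst lborel.emeasure_pair_measure_Times) (auto simp: ennreal_mult)
    also have "(u $ i - l $ i) * (u $ j - l $ j) = (\<Prod>k\<in>UNIV. (u - l) $ k)"
      using ij by (subst UNIV_2_distinct[OF ij]) simp
    also have "\<dots> = (\<Prod>b\<in>Basis. (u - l) \<bullet> b)"
    proof -
      have B: "Basis = (\<lambda>k::2. axis k (1::real)) ` UNIV" by (auto simp: Basis_vec_def)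
      have inj: "inj (\<lambda>k::2. axis k (1::real))" by (auto simp: inj_def axis_eq_axis)
      show ?thesis
        unfolding B prod.reindex[OF inj] by (simp add: cart_eq_inner_axis)
    qed
    finally show "emeasure (distr (lborel \<Otimes>\<^sub>M lborel) borel (\<lambda>z. pt_of i (fst z) (snd z))) (box l u)
        = ennreal (\<Prod>b\<in>Basis. (u - l) \<bullet> b)" .
  qed simp
qed

lemma integral_lborel_pt_of:
  fixes h :: "pt \<Rightarrow> real"
  assumes h: "integrable lborel h"
  shows "(LINT x|lborel. h x) = (LINT y|lborel. LINT x|lborel. h (pt_of i x y))"
proof -
  let ?P = "\<lambda>z. pt_of i (fst z) (snd z)"
  have m: "?P \<in> (lborel \<Otimes>\<^sub>M lborel) \<rightarrow>\<^sub>M borel"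
    using borel_measurable_continuous_onI[OF pt_of_continuous] by (simp add: lborel_prod)
  have "integrable (distr (lborel \<Otimes>\<^sub>M lborel) borel ?P) h"
    using h by (simp add: lborel_eq_distr_pt_of)
  then have "integrable (lborel \<Otimes>\<^sub>M lborel) (\<lambda>z. h (?P z))"
    using h by (subst (asm) integrable_distr_eq[OF m]) auto
  then have int: "integrable (lborel \<Otimes>\<^sub>M lborel) (case_prod (\<lambda>x y. h (pt_of i x y)))"
    by (simp add: case_prod_beta')
  have "(LINT x|lborel. h x) = (LINT x|distr (lborel \<Otimes>\<^sub>M lborel) borel ?P. h x)"
    by (simp add: lborel_eq_distr_pt_of)
  also have "\<dots> = (LINT z|(lborel \<Otimes>\<^sub>M lborel). h (?P z))"
    using h by (intro integral_distr m) auto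
  also have "\<dots> = (LINT z|(lborel \<Otimes>\<^sub>M lborel). case_prod (\<lambda>x y. h (pt_of i x y)) z)"
    by (simp add: case_prod_beta')
  also have "\<dots> = (LINT y|lborel. LINT x|lborel. h (pt_of i x y))"
    using lborel_pair.integral_snd[OF int] by simp
  finally show ?thesis .
qed

text \<open>The sign of the \<open>i\<close>-th component of the outer normal: where the indicator
  is locally constant on either side of \<open>x\<close> along direction \<open>i\<close>, the value
  is 1 if that direction leaves \<open>E\<close>, -1 if it enters, and 0 if both sides
  agree.\<close>

definition edge_jump :: "pt set \<Rightarrow> 2 \<Rightarrow> pt \<Rightarrow> real" where
  "edge_jump E i x = jump (\<lambda>s. indicator E (x + s *\<^sub>R axis i 1)) 0"

lemma edge_jump_bounded: "\<bar>edge_jump E i x\<bar> \<le> 1"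
  unfolding edge_jump_def jump_def by auto

text \<open>\<open>jump\<close> is a limit along a sequence rather than a one-sided limit over the
  reals, so that measurability passes through a countable limit of Borel functions.\<close>

lemma edge_jump_measurable:
  assumes "E \<in> sets borel"
  shows "edge_jump E i \<in> borel_measurable borel"
proof -
  have "(\<lambda>x. indicat_real E (x + c *\<^sub>R axis i 1)) \<in> borel_measurable borel" for c
    using assms by measurable
  then show ?thesis unfolding edge_jump_def[abs_def] jump_def
    by (intro borel_measurable_max borel_measurable_min borel_measurable_const
        borel_measurable_lim_metric borel_measurable_diff) 
qed

lemma edge_jump_pt_of:
  "jump (\<lambda>s. indicator E (pt_of i s y)) x = edge_jump E i (pt_of i x y)"
proof -
  have "pt_of i x y + s *\<^sub>R axis i 1 = pt_of i (x + s) y" for s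
    by (auto simp: pt_of_def vec_eq_iff axis_def)
  then show ?thesis by (simp add: edge_jump_def jump_def)
qed

text \<open>Every line in direction \<open>i\<close>, apart from finitely many, meets the boundary in finitely many points,
  each lying on a single arc; on such a line the identity is the one-dimensional one.\<close>

lemma integral_partial_deriv_polygon:
  fixes m t :: "'e \<Rightarrow> pt" and l :: "'e \<Rightarrow> real" and F :: "pt \<Rightarrow> real" and G :: "pt \<Rightarrow> pt"
  assumes E: "open E" "bounded E" and ij: "i \<noteq> j" and fin: "finite \<E>"
    and cover: "\<And>x. x \<in> frontier E \<Longrightarrow> \<exists>e\<in>\<E>. \<exists>s. \<bar>s\<bar> \<le> l e \<and> x = m e + s *\<^sub>R t e"
    and cross: "\<And>e e' s s'. e \<in> \<E> \<Longrightarrow> e' \<in> \<E> \<Longrightarrow> e \<noteq> e' \<Longrightarrow> \<bar>s\<bar> \<le> l e \<Longrightarrow> \<bar>s'\<bar> \<le> l e' \<Longrightarrow>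
        m e + s *\<^sub>R t e = m e' + s' *\<^sub>R t e' \<Longrightarrow> \<bar>s\<bar> = l e"
    and F: "\<And>x. GDERIV F x :> G x" and G: "continuous_on UNIV G"
  shows "(LINT x|lebesgue_on E. G x $ i) =
     (\<Sum>e\<in>\<E>. \<bar>t e $ j\<bar> * (LINT s|lborel. indicator {- l e..l e} s *
          (edge_jump E i (m e + s *\<^sub>R t e) * F (m e + s *\<^sub>R t e))))"
proof -
  let ?\<gamma> = "\<lambda>e s. m e + s *\<^sub>R t e"
  let ?P = "pt_of i"
  \<comment> \<open>The parameter at which the line carrying the arc \<open>e\<close> reaches level
    \<open>y\<close> of coordinate \<open>j\<close>. It is meaningful on \<open>NH\<close>, the arcs
    not parallel to direction \<open>i\<close>.\<close>
  define \<sigma> where "\<sigma> = (\<lambda>y e. (y - m e $ j) / t e $ j)"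
  define NH where "NH = {e \<in> \<E>. t e $ j \<noteq> 0}"
  define H where "H = (\<lambda>e s. indicator {- l e..l e} s * (edge_jump E i (?\<gamma> e s) * F (?\<gamma> e s)))"
  have finNH: "finite NH" using fin by (simp add: NH_def)
  have NH: "NH \<subseteq> \<E>" by (auto simp: NH_def)
  have Fc: "continuous_on UNIV F"
    using F by (intro differentiable_imp_continuous_on)
      (auto simp: differentiable_on_def gderiv_def differentiable_def)
  have Gi: "continuous_on UNIV (\<lambda>x. G x $ i)" by (intro continuous_intros G)
  have slice_cont: "continuous_on UNIV (\<lambda>x. ?P x y)" for y
    using continuous_on_compose2[OF pt_of_continuous[of i], of UNIV "\<lambda>x. (x, y)"]
    by (simp add: continuous_on_Pair continuous_on_id continuous_on_const)

  \<comment> \<open>The excluded levels pass through an end of an arc or contain an arc parallel to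
    direction \<open>i\<close>.\<close>
  have slice: "(LINT x|lborel. indicator E (?P x y) * G (?P x y) $ i) = (\<Sum>e\<in>NH. H e (\<sigma> y e))"
    if y: "y \<notin> (\<lambda>e. ?\<gamma> e (l e) $ j) ` \<E> \<union> (\<lambda>e. ?\<gamma> e (- l e) $ j) ` \<E> \<union> (\<lambda>e. m e $ j) ` (\<E> - NH)" for y
  proof -
    define U where "U = {x. ?P x y \<in> E}"
    define A where "A = {e \<in> NH. \<bar>\<sigma> y e\<bar> \<le> l e}"
    define X where "X = (\<lambda>e. ?\<gamma> e (\<sigma> y e) $ i)"
    have finA: "finite A" using finNH by (simp add: A_def)
    have A: "A \<subseteq> NH" by (auto simp: A_def)
    have XP: "?P (X e) y = ?\<gamma> e (\<sigma> y e)" if "e \<in> NH" for e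
    proof -
      have "?\<gamma> e (\<sigma> y e) $ j = y" using that by (simp add: \<sigma>_def NH_def)
      then show ?thesis using pt_of_component[OF ij, of "?\<gamma> e (\<sigma> y e)"] by (simp add: X_def)
    qed
    have U_open: "open U"
      using open_vimage[OF E(1) slice_cont[of y]] by (simp add: U_def vimage_def)
    have U_bdd: "bounded U"
    proof -
      obtain r where r: "\<And>x. x \<in> E \<Longrightarrow> norm x \<le> r" using E(2) by (auto simp: bounded_iff)
      have "norm x \<le> r" if "x \<in> U" for x
      proof -
        have "\<bar>?P x y $ i\<bar> \<le> norm (?P x y)" by (rule component_le_norm_cart)
        also have "\<dots> \<le> r" using that r by (simp add: U_def)
        finally show ?thesis by (simp add: pt_of_nth[OF ij])
      qed
      then show ?thesis by (auto simp: bounded_iff)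
    qed
    have U_front: "frontier U \<subseteq> X ` A"
    proof
      fix x assume x: "x \<in> frontier U"
      have "closed {x. ?P x y \<in> closure E}"
        using closed_vimage[OF closed_closure slice_cont[of y], of E] by (simp add: vimage_def)
      moreover have "U \<subseteq> {x. ?P x y \<in> closure E}" using closure_subset by (auto simp: U_def)
      ultimately have "closure U \<subseteq> {x. ?P x y \<in> closure E}" by (rule closure_minimal[rotated])
      with x U_open E(1) have "?P x y \<in> frontier E"
        by (auto simp: frontier_def interior_open U_def)
      then obtain e s where e: "e \<in> \<E>" and s: "\<bar>s\<bar> \<le> l e" and xe: "?P x y = ?\<gamma> e s"
        using cover by blast
      have ys: "y = m e $ j + s * t e $ j"
        using arg_cong[OF xe, of "\<lambda>z. z $ j"] by (simp add: pt_of_nth[OF ij])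
      have eNH: "e \<in> NH"
      proof (rule ccontr)
        assume "e \<notin> NH"
        with e ys have "y = m e $ j" by (simp add: NH_def)
        with y e \<open>e \<notin> NH\<close> show False by blast
      qed
      then have s\<sigma>: "s = \<sigma> y e" by (simp add: \<sigma>_def ys NH_def)
      have "x = X e" using arg_cong[OF xe, of "\<lambda>z. z $ i"] by (simp add: pt_of_nth[OF ij] X_def s\<sigma>)
      moreover have "e \<in> A" using eNH s s\<sigma> by (simp add: A_def)
      ultimately show "x \<in> X ` A" by blast
    qed
    \<comment> \<open>Two different arcs through one point of the line would, by
      \<open>cross\<close>, meet at an end of the first, and such levels are excluded. Each point is
      thus counted once.\<close>
    have inj: "inj_on X A"
    proof (rule inj_onI, rule ccontr)
      fix e e' assume e: "e \<in> A" "e' \<in> A" and X: "X e = X e'" and ne: "e \<noteq> e'"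
      then have "?\<gamma> e (\<sigma> y e) = ?\<gamma> e' (\<sigma> y e')" using XP A by (metis subsetD)
      then have abs: "\<bar>\<sigma> y e\<bar> = l e" using e ne A NH by (intro cross[of e e']) (auto simp: A_def)
      have "\<sigma> y e = l e \<or> \<sigma> y e = - l e" using abs by linarith
      moreover have "y = ?\<gamma> e (\<sigma> y e) $ j" using e A by (auto simp: \<sigma>_def NH_def)
      ultimately have "y = ?\<gamma> e (l e) $ j \<or> y = ?\<gamma> e (- l e) $ j"
        by metis
      with y e A NH show False by blast
    qed
    have der: "((\<lambda>x. F (?P x y)) has_real_derivative G (?P x y) $ i) (at x)" for x
    proof -
      have P: "?P x' y = ?P 0 y + x' *\<^sub>R axis i 1" for x'
        by (auto simp: pt_of_def vec_eq_iff axis_def)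
      have "((\<lambda>x'. ?P 0 y + x' *\<^sub>R axis i 1) has_derivative (\<lambda>x'. x' *\<^sub>R axis i 1)) (at x)"
        by (auto intro!: derivative_eq_intros)
      then have "((\<lambda>x'. ?P x' y) has_derivative (\<lambda>x'. x' *\<^sub>R axis i 1)) (at x)"
        by (simp flip: P)
      from has_derivative_compose[OF this F[of "?P x y", unfolded gderiv_def]]
      have "((\<lambda>x'. F (?P x' y)) has_derivative (\<lambda>x'. x' *\<^sub>R axis i 1 \<bullet> G (?P x y))) (at x)" .
      moreover have "(\<lambda>x'. x' *\<^sub>R axis i 1 \<bullet> G (?P x y)) = (*) (G (?P x y) $ i)"
        by (auto simp: cart_eq_inner_axis inner_commute)
      ultimately show ?thesis by (simp add: has_field_derivative_def)
    qed
    have cont': "continuous_on UNIV (\<lambda>x. G (?P x y) $ i)"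
      using continuous_on_compose2[OF Gi slice_cont] by simp
    have "(LINT x|lborel. indicator E (?P x y) * G (?P x y) $ i)
        = (LINT x|lborel. indicator U x * G (?P x y) $ i)"
      by (simp add: U_def indicator_def)
    also have "\<dots> = (\<Sum>z\<in>X ` A. jump (indicator U) z * F (?P z y))"
      using finA by (intro integral_indicator_finite_frontier U_open U_bdd U_front der cont') auto
    also have "\<dots> = (\<Sum>e\<in>A. jump (indicator U) (X e) * F (?P (X e) y))"
      by (simp add: sum.reindex[OF inj])
    also have "\<dots> = (\<Sum>e\<in>A. H e (\<sigma> y e))"
    proof (rule sum.cong)
      fix e assume e: "e \<in> A"
      have "(indicator U :: real \<Rightarrow> real) = (\<lambda>s. indicator E (?P s y))"
        by (auto simp: U_def indicator_def)
      then have "jump (indicator U) (X e) = edge_jump E i (?P (X e) y)"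
        by (simp add: edge_jump_pt_of)
      with e A show "jump (indicator U) (X e) * F (?P (X e) y) = H e (\<sigma> y e)"
        by (auto simp: H_def XP A_def abs_le_iff)
    qed simp
    also have "\<dots> = (\<Sum>e\<in>NH. H e (\<sigma> y e))"
      using finNH by (intro sum.mono_neutral_left A) (auto simp: A_def H_def indicator_def abs_le_iff)
    finally show ?thesis .
  qed

  have H_int: "integrable lborel (H e)" for e
  proof -
    have g: "continuous_on UNIV (?\<gamma> e)" by (intro continuous_intros)
    have Fg: "continuous_on UNIV (\<lambda>s. F (?\<gamma> e s))" using continuous_on_compose2[OF Fc g] by simp
    have "set_integrable lborel {- l e..l e} (\<lambda>s. F (?\<gamma> e s))"
      by (intro borel_integrable_atLeastAtMost' continuous_on_subset[OF Fg]) auto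
    then have I: "integrable lborel (\<lambda>s. indicator {- l e..l e} s * F (?\<gamma> e s))"
      by (simp add: set_integrable_def)
    have "(\<lambda>s. edge_jump E i (?\<gamma> e s)) \<in> borel_measurable lborel"
      using measurable_compose[OF borel_measurable_continuous_onI[OF g] edge_jump_measurable, of E i] E(1)
      by simp
    then have m: "H e \<in> borel_measurable lborel"
      using borel_measurable_continuous_onI[OF Fg] unfolding H_def by simp
    show ?thesis
    proof (rule Bochner_Integration.integrable_bound[OF I m])
      have "\<bar>H e s\<bar> \<le> \<bar>indicator {- l e..l e} s * F (?\<gamma> e s)\<bar>" for s
        using mult_right_mono[OF edge_jump_bounded[of E i "?\<gamma> e s"], of "\<bar>F (?\<gamma> e s)\<bar>"]
        by (auto simp: H_def indicator_def abs_mult)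
      then show "AE s in lborel. norm (H e s) \<le> norm (indicator {- l e..l e} s * F (?\<gamma> e s))"
        by (intro AE_I2) (simp only: real_norm_def)
    qed
  qed
  \<comment> \<open>Passing from the level \<open>y\<close> to the arc parameter produces the weight
    \<open>|t e $ j|\<close>. It is 0 on arcs parallel to direction \<open>i\<close>, which can
    therefore be put back into the sum at the end.\<close>
  have affine: "(LINT y|lborel. H e (\<sigma> y e)) = \<bar>t e $ j\<bar> * (LINT s|lborel. H e s)"
    "integrable lborel (\<lambda>y. H e (\<sigma> y e))" if "e \<in> NH" for e
  proof -
    have nz: "t e $ j \<noteq> 0" using that by (simp add: NH_def)
    then show "(LINT y|lborel. H e (\<sigma> y e)) = \<bar>t e $ j\<bar> * (LINT s|lborel. H e s)"
      using lborel_integral_real_affine[of "t e $ j" "\<lambda>y. H e (\<sigma> y e)" "m e $ j"] by (simp add: \<sigma>_def)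
    have \<sigma>: "\<sigma> y e = - m e $ j / t e $ j + (1 / t e $ j) * y" for y
      by (simp add: \<sigma>_def diff_divide_distrib)
    show "integrable lborel (\<lambda>y. H e (\<sigma> y e))"
      unfolding \<sigma> using nz by (intro lborel_integrable_real_affine H_int) simp
  qed

  have Gint: "integrable lborel (\<lambda>x. indicator E x * G x $ i)"
  proof -
    have "integrable (lebesgue_on E) (\<lambda>x. G x $ i)"
      by (rule integrable_continuous_lebesgue_on[OF Gi E])
    then have "integrable lebesgue (\<lambda>x. indicator E x *\<^sub>R G x $ i)"
      using E(1) by (subst (asm) integrable_restrict_space) (auto simp: borel_open)
    then show ?thesis
      using E(1) borel_measurable_continuous_onI[OF Gi]
      by (subst (asm) integrable_completion) (auto simp: borel_open)
  qed
  have "(LINT x|lebesgue_on E. G x $ i) = (LINT x|lebesgue. indicator E x * G x $ i)"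
    using E(1) by (subst integral_restrict_space) (auto simp: borel_open)
  also have "\<dots> = (LINT x|lborel. indicator E x * G x $ i)"
    using Gint by (intro integral_completion) auto
  also have "\<dots> = (LINT y|lborel. LINT x|lborel. indicator E (?P x y) * G (?P x y) $ i)"
    by (rule integral_lborel_pt_of[OF Gint])
  also have "\<dots> = (LINT y|lborel. (\<Sum>e\<in>NH. H e (\<sigma> y e)))"
  proof (rule integral_cong_AE)
    let ?B = "(\<lambda>e. ?\<gamma> e (l e) $ j) ` \<E> \<union> (\<lambda>e. ?\<gamma> e (- l e) $ j) ` \<E> \<union> (\<lambda>e. m e $ j) ` (\<E> - NH)"
    have "finite ?B" using fin by simp
    then have "AE y in lborel. y \<notin> ?B"
      by (intro AE_not_in finite_imp_null_set_lborel)
    then show "AE y in lborel. (LINT x|lborel. indicator E (?P x y) * G (?P x y) $ i) = (\<Sum>e\<in>NH. H e (\<sigma> y e))"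
      by eventually_elim (rule slice)
    show "(\<lambda>y. LINT x|lborel. indicator E (?P x y) * G (?P x y) $ i) \<in> borel_measurable lborel"
    proof (rule lborel.borel_measurable_lebesgue_integral)
      have "(\<lambda>z. indicator E (?P (snd z) (fst z)) * G (?P (snd z) (fst z)) $ i)
          \<in> borel_measurable (lborel \<Otimes>\<^sub>M lborel)"
      proof -
        have c: "continuous_on UNIV (\<lambda>z. ?P (snd z) (fst z))"
          using continuous_on_compose2[OF pt_of_continuous[of i], of UNIV "\<lambda>z. (snd z, fst z)"]
          by (simp add: continuous_on_Pair continuous_on_fst continuous_on_snd continuous_on_id)
        have "(\<lambda>x. indicator E x * G x $ i) \<in> borel_measurable borel" using Gint by auto
        from measurable_compose[OF borel_measurable_continuous_onI[OF c] this]
        show ?thesis by (simp add: lborel_prod)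
      qed
      then show "case_prod (\<lambda>y x. indicator E (?P x y) * G (?P x y) $ i)
          \<in> borel_measurable (lborel \<Otimes>\<^sub>M lborel)"
        by (simp add: case_prod_beta')
    qed
    show "(\<lambda>y. \<Sum>e\<in>NH. H e (\<sigma> y e)) \<in> borel_measurable lborel"
      using affine(2) by (intro borel_measurable_sum) auto
  qed
  also have "\<dots> = (\<Sum>e\<in>NH. \<bar>t e $ j\<bar> * (LINT s|lborel. H e s))"
    using affine by (subst Bochner_Integration.integral_sum) auto
  also have "\<dots> = (\<Sum>e\<in>\<E>. \<bar>t e $ j\<bar> * (LINT s|lborel. H e s))"
    using fin by (intro sum.mono_neutral_left NH) (auto simp: NH_def)
  finally show ?thesis by (simp only: H_def)
qed


section \<open>Normal traces\<close>

lemma perp_nth [simp]: "perp a $ 1 = - (a $ 2)" "perp a $ 2 = a $ 1"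
  by (simp_all add: perp_def vector_2)

lemma norm_perp [simp]: "norm (perp a) = norm a"
  by (simp add: norm_eq_sqrt_inner inner_vec_def sum_2)

lemma orthogonal_eq_scaleR_perp:
  assumes "norm n = 1" "n \<bullet> d = 0"
  shows "d = (d \<bullet> perp n) *\<^sub>R perp n"
proof -
  have n: "n $ 1 * n $ 1 + n $ 2 * n $ 2 = 1"
    using assms(1) by (simp add: norm_eq_sqrt_inner inner_vec_def sum_2)
  have d: "n $ 1 * d $ 1 + n $ 2 * d $ 2 = 0"
    using assms(2) by (simp add: inner_vec_def sum_2)
  have "d $ 1 = (d $ 2 * n $ 1 - d $ 1 * n $ 2) * (- (n $ 2))"
    "d $ 2 = (d $ 2 * n $ 1 - d $ 1 * n $ 2) * n $ 1"
    using n d by algebra+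
  then show ?thesis by (simp add: vec_eq_iff forall_2 inner_vec_def sum_2 algebra_simps)
qed

lemma diameter_closed_segment_eq:
  fixes a b :: "'a::euclidean_space"
  shows "diameter (closed_segment a b) = norm (b - a)"
proof (rule antisym)
  show "diameter (closed_segment a b) \<le> norm (b - a)"
  proof (rule diameter_le)
    fix x y assume "x \<in> closed_segment a b" "y \<in> closed_segment a b"
    then obtain u v where uv: "0 \<le> u" "u \<le> 1" "x = (1 - u) *\<^sub>R a + u *\<^sub>R b"
      "0 \<le> v" "v \<le> 1" "y = (1 - v) *\<^sub>R a + v *\<^sub>R b"
      by (auto simp: closed_segment_def)
    have "x - y = (u - v) *\<^sub>R (b - a)" unfolding uv(3,6) by (simp add: algebra_simps)
    then have "norm (x - y) = \<bar>u - v\<bar> * norm (b - a)" by simp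
    also have "\<dots> \<le> 1 * norm (b - a)" using uv by (intro mult_right_mono) auto
    finally show "norm (x - y) \<le> norm (b - a)" by simp
  qed simp
  show "norm (b - a) \<le> diameter (closed_segment a b)"
    using diameter_bounded_bound[OF bounded_closed_segment, of b a b a] by (simp add: dist_norm)
qed

text \<open>Midpoint, length and normal come from a definite description, a diameter and a field of
  the record. Here they are tied together: \<open>edge_point\<close> runs over exactly the edge, at
  unit speed and centred at the midpoint.\<close>

lemma mesh_edge_geometry:
  assumes "is_mesh \<Omega> M" "E \<in> elements M" "e \<in> edges M E"
  shows "norm (perp (normal M e)) = 1" (is ?norm)
    and "0 < edge_length e" (is ?pos)
    and "e = edge_point M e ` {- (edge_length e / 2)..edge_length e / 2}" (is ?param)
    and "\<And>s. edge_point M e s extreme_point_of e \<Longrightarrow> \<bar>s\<bar> = edge_length e / 2"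
proof -
  let ?n = "normal M e"
  from assms have "norm ?n = 1 \<and> (\<forall>x\<in>e. \<forall>y\<in>e. ?n \<bullet> (x - y) = 0)"
    and "polygon_with_edges E (edges M E)"
    unfolding is_mesh_def by blast+
  then have n: "norm ?n = 1" and orth: "\<And>x y. x \<in> e \<Longrightarrow> y \<in> e \<Longrightarrow> ?n \<bullet> (x - y) = 0"
    and "is_segment e"
    using assms(3) by (simp_all add: polygon_with_edges_def)
  from \<open>is_segment e\<close> obtain a b where ab: "a \<noteq> b" "e = closed_segment a b" unfolding is_segment_def by blast
  have len: "edge_length e = norm (b - a)"
    by (simp add: ab edge_length_def diameter_closed_segment_eq)
  \<comment> \<open>A segment determines its endpoints up to order, and the midpoint is symmetric in
    them.\<close>
  have mid: "edge_mid e = midpoint a b"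
    unfolding edge_mid_def
  proof (rule the_equality)
    show "\<exists>a' b'. e = closed_segment a' b' \<and> midpoint a b = midpoint a' b'" using ab by blast
    fix x assume "\<exists>a b. e = closed_segment a b \<and> x = midpoint a b"
    then show "x = midpoint a b" by (auto simp: ab doubleton_eq_iff midpoint_sym)
  qed
  \<comment> \<open>The signed length along the unit tangent. Its sign depends on whether the
    tangent points from \<open>a\<close> to \<open>b\<close>, so only \<open>|c|\<close> is
    determined by the edge.\<close>
  define c where "c = (b - a) \<bullet> perp ?n"
  have "?n \<bullet> (b - a) = 0" by (intro orth) (auto simp: ab)
  then have ba: "b - a = c *\<^sub>R perp ?n"
    unfolding c_def by (rule orthogonal_eq_scaleR_perp[OF n])
  show ?norm using n by simp
  show ?pos unfolding len using ab(1) by simp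
  have c: "\<bar>c\<bar> = edge_length e" by (simp add: len ba n)
  have c0: "c \<noteq> 0" using c \<open>?pos\<close> by auto
  \<comment> \<open>The length coordinate expressed in the segment parameter: \<open>s = 0\<close>
    corresponds to 1/2, and the ends of the edge to 0 and 1.\<close>
  have pt: "edge_point M e s = a + (1 / 2 + s / c) *\<^sub>R (b - a)" for s
  proof -
    have "a + (1 / 2 + s / c) *\<^sub>R (b - a) = a + (1 / 2) *\<^sub>R (b - a) + (s / c) *\<^sub>R (b - a)"
      by (simp add: scaleR_add_left)
    also have "(s / c) *\<^sub>R (b - a) = s *\<^sub>R perp ?n" using c0 by (simp add: ba)
    also have "a + (1 / 2) *\<^sub>R (b - a) = midpoint a b"
      by (simp add: midpoint_def vec_eq_iff field_simps)
    finally show ?thesis by (simp add: edge_point_def mid)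
  qed
  show ?param
  proof (intro equalityI subsetI)
    fix x assume "x \<in> e"
    then obtain u where u: "0 \<le> u" "u \<le> 1" "x = (1 - u) *\<^sub>R a + u *\<^sub>R b"
      by (auto simp: ab closed_segment_def)
    have "1 / 2 + (u - 1 / 2) * c / c = u" using c0 by simp
    then have "x = edge_point M e ((u - 1 / 2) * c)"
      unfolding pt u(3) by (simp only:) (simp add: algebra_simps)
    moreover have "\<bar>u - 1 / 2\<bar> \<le> 1 / 2" using u(1,2) by (simp only: abs_le_iff) linarith
    then have "\<bar>(u - 1 / 2) * c\<bar> \<le> 1 / 2 * edge_length e"
      unfolding abs_mult c[symmetric] by (intro mult_right_mono) auto
    then have "(u - 1 / 2) * c \<in> {- (edge_length e / 2)..edge_length e / 2}" by (auto simp: abs_le_iff)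
    ultimately show "x \<in> edge_point M e ` {- (edge_length e / 2)..edge_length e / 2}" by blast
  next
    fix x assume "x \<in> edge_point M e ` {- (edge_length e / 2)..edge_length e / 2}"
    then obtain s where s: "x = edge_point M e s" "\<bar>s\<bar> \<le> edge_length e / 2" by (auto simp: abs_le_iff)
    have "\<bar>s / c\<bar> \<le> 1 / 2" using s(2) \<open>?pos\<close> by (simp add: abs_divide c divide_le_eq)
    then have "0 \<le> 1 / 2 + s / c" "1 / 2 + s / c \<le> 1" by linarith+
    moreover have "a + r *\<^sub>R (b - a) = (1 - r) *\<^sub>R a + r *\<^sub>R b" for r
      by (simp add: algebra_simps)
    then have "x = (1 - (1 / 2 + s / c)) *\<^sub>R a + (1 / 2 + s / c) *\<^sub>R b"
      unfolding s(1) pt by blast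
    ultimately have "x \<in> closed_segment a b" unfolding closed_segment_def by blast
    then show "x \<in> e" using ab(2) by blast
  qed
  show "\<bar>s\<bar> = edge_length e / 2" if "edge_point M e s extreme_point_of e" for s
  proof -
    have "edge_point M e s = a \<or> edge_point M e s = b"
      using that by (simp add: ab extreme_point_of_segment)
    then have "1 / 2 + s / c = 0 \<or> 1 / 2 + s / c = 1"
    proof
      assume "edge_point M e s = a"
      then show ?thesis using ab(1) by (simp add: pt)
    next
      assume "edge_point M e s = b"
      then have "(1 / 2 + s / c) *\<^sub>R (b - a) = b - a" by (simp only: pt eq_diff_eq add.commute)
      then have "(1 / 2 + s / c) *\<^sub>R (b - a) = 1 *\<^sub>R (b - a)" by simp
      then show ?thesis using ab(1) by (simp only: scaleR_cancel_right) simp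
    qed
    then have "\<bar>s / c\<bar> = 1 / 2" by linarith
    then show ?thesis using \<open>?pos\<close> by (simp add: abs_divide c field_simps)
  qed
qed

lemma mesh_element:
  assumes "is_mesh \<Omega> M" "E \<in> elements M"
  shows "open E" "bounded E" "finite (edges M E)" "frontier E = \<Union>(edges M E)"
proof -
  have "polygon_with_edges E (edges M E)" using assms unfolding is_mesh_def by blast
  then show "open E" "bounded E" "finite (edges M E)" "frontier E = \<Union>(edges M E)"
    unfolding polygon_with_edges_def by simp_all
qed

lemma mesh_edges_cross:
  assumes M: "is_mesh \<Omega> M" "E \<in> elements M" and e: "e \<in> edges M E" "e' \<in> edges M E" "e \<noteq> e'"
    and s: "edge_point M e s \<in> e" "edge_point M e s \<in> e'"
  shows "\<bar>s\<bar> = edge_length e / 2"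
proof (rule mesh_edge_geometry(4)[OF M e(1)])
  show "edge_point M e s extreme_point_of e"
  proof -
    have "polygon_with_edges E (edges M E)" using M unfolding is_mesh_def by blast
    then have "\<forall>x\<in>e \<inter> e'. x extreme_point_of e \<and> x extreme_point_of e'"
      using e unfolding polygon_with_edges_def by simp
    then show ?thesis using s by blast
  qed
qed

lemma edge_point_mem:
  assumes "is_mesh \<Omega> M" "E \<in> elements M" "e \<in> edges M E" "\<bar>s\<bar> \<le> edge_length e / 2"
  shows "edge_point M e s \<in> e"
proof -
  have "edge_point M e s \<in> edge_point M e ` {- (edge_length e / 2)..edge_length e / 2}"
    using assms(4) by (intro imageI) (auto simp: abs_le_iff)
  then show ?thesis using mesh_edge_geometry(3)[OF assms(1-3)] by simp
qed

lemma space_edge_measure: "space (edge_measure e) = {- edge_length e / 2 .. edge_length e / 2}"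
  by (simp add: edge_measure_def)

lemma edge_point_continuous: "continuous_on UNIV (edge_point M e)"
  unfolding edge_point_def[abs_def] by (intro continuous_intros)

lemma edge_measure_measurable:
  "g \<in> borel_measurable borel \<Longrightarrow> g \<in> borel_measurable (edge_measure e)"
  unfolding edge_measure_def
  by (intro measurable_restrict_space1 measurable_completion) simp

lemma finite_edge_measure: "finite_measure (edge_measure e)"
  unfolding edge_measure_def by (intro finite_measure_lebesgue_on) simp

lemma bounded_integrable_edge_measure:
  fixes g :: "real \<Rightarrow> real"
  assumes "g \<in> borel_measurable borel" "\<And>s. s \<in> space (edge_measure e) \<Longrightarrow> \<bar>g s\<bar> \<le> B"
  shows "integrable (edge_measure e) g"
  using assms by (intro finite_measure.integrable_const_bound[OF finite_edge_measure, where B = B]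
      AE_I2 edge_measure_measurable) auto

section \<open>Green's formula on an element\<close>

text \<open>The \<open>i\<close>-th component of the outer unit normal. A right-angle turn exchanges
  the coordinates up to sign, so the modulus is that of \<open>normal M e $ i\<close>; the sign
  comes from \<open>edge_jump\<close>.\<close>

definition green_weight :: "mesh \<Rightarrow> pt set \<Rightarrow> 2 \<Rightarrow> pt set \<Rightarrow> pt \<Rightarrow> real" where
  "green_weight M E i e x = \<bar>perp (normal M e) $ (if i = 1 then 2 else 1)\<bar> * edge_jump E i x"

lemma green_weight_integrable:
  assumes E: "open E" and F: "continuous_on UNIV F"
  shows "integrable (edge_measure e) (\<lambda>s. green_weight M E i e (edge_point M e s) * F (edge_point M e s))"
proof -
  have Fe: "continuous_on UNIV (\<lambda>s. F (edge_point M e s))"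
    using continuous_on_compose2[OF F edge_point_continuous] by simp
  obtain B where B: "\<And>s. s \<in> space (edge_measure e) \<Longrightarrow> \<bar>F (edge_point M e s)\<bar> \<le> B"
  proof -
    have "bounded (space (edge_measure e))" by (simp add: space_edge_measure)
    from continuous_on_UNIV_bounded_image[OF Fe this] show thesis
      using that by (auto simp: bounded_iff)
  qed
  define a where "a = \<bar>perp (normal M e) $ (if i = 1 then 2 else 1)\<bar>"
  show ?thesis
  proof (rule bounded_integrable_edge_measure[where B = "a * (1 * B)"])
    have "(\<lambda>s. edge_jump E i (edge_point M e s)) \<in> borel_measurable borel"
      using measurable_compose[OF borel_measurable_continuous_onI[OF edge_point_continuous]
          edge_jump_measurable] E by simp
    then show "(\<lambda>s. green_weight M E i e (edge_point M e s) * F (edge_point M e s)) \<in> borel_measurable borel"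
      using borel_measurable_continuous_onI[OF Fe] unfolding green_weight_def by simp
    fix s assume "s \<in> space (edge_measure e)"
    then have "a * (\<bar>edge_jump E i (edge_point M e s)\<bar> * \<bar>F (edge_point M e s)\<bar>) \<le> a * (1 * B)"
      using edge_jump_bounded B unfolding a_def by (intro mult_left_mono mult_mono) auto
    then show "\<bar>green_weight M E i e (edge_point M e s) * F (edge_point M e s)\<bar> \<le> a * (1 * B)"
      by (simp add: green_weight_def abs_mult a_def mult.assoc)
  qed
qed

text \<open>The arcs are the edges, with unit tangent \<open>perp (normal M e)\<close> and half the
  edge length as parameter bound. What remains is the passage between Lebesgue and Borel measure on
  the edge.\<close>

lemma integral_partial_deriv_element:
  assumes M: "is_mesh \<Omega> M" "E \<in> elements M"
    and F: "\<And>x. GDERIV F x :> G x" and G: "continuous_on UNIV G"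
  shows "(LINT x|lebesgue_on E. G x $ i) =
     (\<Sum>e\<in>edges M E. edge_integral M e (\<lambda>x. green_weight M E i e x * F x))"
proof -
  note E = mesh_element[OF M]
  let ?j = "if i = 1 then 2 else 1 :: 2"
  have ij: "i \<noteq> ?j" using exhaust_2[of i] by auto
  have Fc: "continuous_on UNIV F"
    using F by (intro differentiable_imp_continuous_on)
      (auto simp: differentiable_on_def gderiv_def differentiable_def)
  have "(LINT x|lebesgue_on E. G x $ i) =
     (\<Sum>e\<in>edges M E. \<bar>perp (normal M e) $ ?j\<bar> *
       (LINT s|lborel. indicator {- (edge_length e / 2)..edge_length e / 2} s *
          (edge_jump E i (edge_mid e + s *\<^sub>R perp (normal M e)) * F (edge_mid e + s *\<^sub>R perp (normal M e)))))"
  proof (rule integral_partial_deriv_polygon[OF E(1,2) ij E(3) _ _ F G], fold edge_point_def)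
    fix x assume "x \<in> frontier E"
    then obtain e where e: "e \<in> edges M E" "x \<in> e" using E(4) by blast
    then have "x \<in> edge_point M e ` {- (edge_length e / 2)..edge_length e / 2}"
      using mesh_edge_geometry(3)[OF M e(1)] by simp
    with e(1) show "\<exists>e\<in>edges M E. \<exists>s. \<bar>s\<bar> \<le> edge_length e / 2 \<and> x = edge_point M e s"
      by (force simp: abs_le_iff)
  next
    fix e e' s s'
    assume "e \<in> edges M E" "e' \<in> edges M E" "e \<noteq> e'" "\<bar>s\<bar> \<le> edge_length e / 2"
      "\<bar>s'\<bar> \<le> edge_length e' / 2" "edge_point M e s = edge_point M e' s'"
    then show "\<bar>s\<bar> = edge_length e / 2"
      using edge_point_mem[OF M, of e s] edge_point_mem[OF M, of e' s']
      by (intro mesh_edges_cross[OF M, of e e']) simp_all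
  qed
  also have "\<dots> = (\<Sum>e\<in>edges M E. edge_integral M e (\<lambda>x. green_weight M E i e x * F x))"
  proof (rule sum.cong)
    fix e assume e: "e \<in> edges M E"
    let ?h = "\<lambda>s. edge_jump E i (edge_point M e s) * F (edge_point M e s)"
    let ?I = "{- (edge_length e / 2)..edge_length e / 2}"
    have h: "?h \<in> borel_measurable borel"
    proof -
      have "(\<lambda>s. edge_jump E i (edge_point M e s)) \<in> borel_measurable borel"
        using measurable_compose[OF borel_measurable_continuous_onI[OF edge_point_continuous]
            edge_jump_measurable] E(1) by simp
      moreover have "(\<lambda>s. F (edge_point M e s)) \<in> borel_measurable borel"
        using continuous_on_compose2[OF Fc edge_point_continuous]
        by (intro borel_measurable_continuous_onI) simp
      ultimately show ?thesis by simp
    qed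
    have "edge_integral M e (\<lambda>x. green_weight M E i e x * F x)
        = \<bar>perp (normal M e) $ ?j\<bar> * (LINT s|edge_measure e. ?h s)"
      unfolding edge_integral_def green_weight_def by (simp add: mult.assoc)
    also have "(LINT s|edge_measure e. ?h s) = (LINT s|lebesgue. indicator ?I s * ?h s)"
      unfolding edge_measure_def by (subst integral_restrict_space) auto
    also have "\<dots> = (LINT s|lborel. indicator ?I s * ?h s)"
      using h by (intro integral_completion) simp
    finally show "\<bar>perp (normal M e) $ ?j\<bar> *
       (LINT s|lborel. indicator ?I s * (edge_jump E i (edge_mid e + s *\<^sub>R perp (normal M e)) *
          F (edge_mid e + s *\<^sub>R perp (normal M e))))
       = edge_integral M e (\<lambda>x. green_weight M E i e x * F x)"
      by (simp add: edge_point_def)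
  qed simp
  finally show ?thesis .
qed

lemma edge_sign_square: "edge_sign M E e * edge_sign M E e = 1"
  by (simp add: edge_sign_def)

section \<open>Linearity and existence of normal traces\<close>

lemma Lp_space_2_combination:
  fixes f g :: "pt \<Rightarrow> 'b::euclidean_space"
  assumes "f \<in> Lp_space 2 S" "g \<in> Lp_space 2 S"
  shows "(\<lambda>x. f x + c *\<^sub>R g x) \<in> Lp_space 2 S"
proof -
  from assms have m: "f \<in> borel_measurable (lebesgue_on S)" "g \<in> borel_measurable (lebesgue_on S)"
    and i: "integrable (lebesgue_on S) (\<lambda>x. norm (f x) powr 2)"
      "integrable (lebesgue_on S) (\<lambda>x. norm (g x) powr 2)"
    by (auto simp: Lp_space_def)
  have "integrable (lebesgue_on S) (\<lambda>x. 2 * norm (f x) powr 2 + (2 * c\<^sup>2) * norm (g x) powr 2)"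
    by (intro Bochner_Integration.integrable_add integrable_mult_right i)
  then have "integrable (lebesgue_on S) (\<lambda>x. norm (f x + c *\<^sub>R g x) powr 2)"
  proof (rule Bochner_Integration.integrable_bound)
    show "(\<lambda>x. norm (f x + c *\<^sub>R g x) powr 2) \<in> borel_measurable (lebesgue_on S)"
      using m by simp
    have "norm (f x + c *\<^sub>R g x) powr 2 \<le> 2 * norm (f x) powr 2 + (2 * c\<^sup>2) * norm (g x) powr 2" for x
    proof -
      have "norm (f x + c *\<^sub>R g x) \<le> norm (f x) + \<bar>c\<bar> * norm (g x)"
        using norm_triangle_ineq[of "f x" "c *\<^sub>R g x"] by simp
      then have "(norm (f x + c *\<^sub>R g x))\<^sup>2 \<le> (norm (f x) + \<bar>c\<bar> * norm (g x))\<^sup>2"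
        by (intro power_mono) auto
      also have "\<dots> \<le> 2 * (norm (f x))\<^sup>2 + 2 * (\<bar>c\<bar> * norm (g x))\<^sup>2"
        using zero_le_power2[of "norm (f x) - \<bar>c\<bar> * norm (g x)"] by (simp add: power2_sum power2_diff)
      finally show ?thesis by (simp add: powr_numeral power_mult_distrib)
    qed
    then show "AE x in lebesgue_on S. norm (norm (f x + c *\<^sub>R g x) powr 2)
        \<le> norm (2 * norm (f x) powr 2 + (2 * c\<^sup>2) * norm (g x) powr 2)"
      by (intro AE_I2) (simp add: order.trans[OF _ abs_ge_self])
  qed
  with m show ?thesis by (simp add: Lp_space_def)
qed

lemma weak_div_combination:
  assumes E: "open E" "bounded E"
    and v: "integrable (lebesgue_on E) v" "weak_div E v d"
    and w: "integrable (lebesgue_on E) w" "weak_div E w d'"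
  shows "weak_div E (\<lambda>x. v x + c *\<^sub>R w x) (\<lambda>x. d x + c * d' x)"
  unfolding weak_div_def
proof (intro conjI ballI)
  show "(\<lambda>x. d x + c * d' x) \<in> Lp_space 2 E"
    using Lp_space_2_combination[of d E d' c] v(2) w(2) by (simp add: weak_div_def)
  fix \<phi> assume \<phi>: "\<phi> \<in> test_functions E"
  then have s: "smooth \<phi>" by (simp add: test_functions_def)
  have d: "integrable (lebesgue_on E) d" "integrable (lebesgue_on E) d'"
    using v(2) w(2) Lp_space_2_integrable[OF _ E] by (auto simp: weak_div_def)
  note I = integrable_inner_continuous[OF _ smooth_continuous_grad[OF s] E(2)]
    and I' = integrable_mult_continuous[OF _ smooth_continuous[OF s] E(2)]
  have "(LINT x|lebesgue_on E. (v x + c *\<^sub>R w x) \<bullet> grad \<phi> x)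
      = (LINT x|lebesgue_on E. v x \<bullet> grad \<phi> x + c * (w x \<bullet> grad \<phi> x))"
    by (simp add: inner_add_left)
  also have "\<dots> = (LINT x|lebesgue_on E. v x \<bullet> grad \<phi> x) + c * (LINT x|lebesgue_on E. w x \<bullet> grad \<phi> x)"
    using I[OF v(1)] I[OF w(1)] by simp
  also have "\<dots> = - ((LINT x|lebesgue_on E. d x * \<phi> x) + c * (LINT x|lebesgue_on E. d' x * \<phi> x))"
    using v(2) w(2) \<phi> by (simp add: weak_div_def)
  also have "(LINT x|lebesgue_on E. d x * \<phi> x) + c * (LINT x|lebesgue_on E. d' x * \<phi> x)
      = (LINT x|lebesgue_on E. d x * \<phi> x + c * (d' x * \<phi> x))"
    using I'[OF d(1)] I'[OF d(2)] by simp
  also have "\<dots> = (LINT x|lebesgue_on E. (d x + c * d' x) * \<phi> x)"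
    by (simp add: algebra_simps)
  finally show "(LINT x|lebesgue_on E. (v x + c *\<^sub>R w x) \<bullet> grad \<phi> x) =
      - (LINT x|lebesgue_on E. (d x + c * d' x) * \<phi> x)" .
qed

lemma integrable_edge_mult_continuous:
  fixes g h :: "pt \<Rightarrow> real"
  assumes g: "integrable (edge_measure e) (\<lambda>s. g (edge_point M e s))" and h: "continuous_on UNIV h"
  shows "integrable (edge_measure e) (\<lambda>s. g (edge_point M e s) * h (edge_point M e s))"
proof -
  have "continuous_on UNIV (\<lambda>s. h (edge_point M e s))"
    using continuous_on_compose2[OF h edge_point_continuous] by simp
  from integrable_inner_continuous[OF g[unfolded edge_measure_def] this]
  show ?thesis by (simp add: edge_measure_def inner_real_def)
qed

text \<open>The scalar serves two purposes: \<open>c = 1\<close> for the sum of two residuals,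
  \<open>c = - 1\<close> for subtracting a projection from a field.\<close>

lemma has_normal_trace_combination:
  assumes E: "open E" "bounded E"
    and v: "integrable (lebesgue_on E) v" "has_normal_trace M E v g"
    and w: "integrable (lebesgue_on E) w" "has_normal_trace M E w g'"
  shows "has_normal_trace M E (\<lambda>x. v x + c *\<^sub>R w x) (\<lambda>e x. g e x + c * g' e x)"
proof -
  from v(2) obtain d where gi: "\<And>e. e \<in> edges M E \<Longrightarrow> integrable (edge_measure e) (\<lambda>s. g e (edge_point M e s))"
    and d: "weak_div E v d" and
    dg: "\<And>\<phi>. smooth \<phi> \<Longrightarrow> (LINT x|lebesgue_on E. v x \<bullet> grad \<phi> x + d x * \<phi> x) =
           (\<Sum>e\<in>edges M E. edge_sign M E e * edge_integral M e (\<lambda>x. g e x * \<phi> x))"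
    unfolding has_normal_trace_def by auto
  from w(2) obtain d' where gi': "\<And>e. e \<in> edges M E \<Longrightarrow> integrable (edge_measure e) (\<lambda>s. g' e (edge_point M e s))"
    and d': "weak_div E w d'" and
    dg': "\<And>\<phi>. smooth \<phi> \<Longrightarrow> (LINT x|lebesgue_on E. w x \<bullet> grad \<phi> x + d' x * \<phi> x) =
           (\<Sum>e\<in>edges M E. edge_sign M E e * edge_integral M e (\<lambda>x. g' e x * \<phi> x))"
    unfolding has_normal_trace_def by auto
  have di: "integrable (lebesgue_on E) d" "integrable (lebesgue_on E) d'"
    using d d' Lp_space_2_integrable[OF _ E] by (auto simp: weak_div_def)
  have eq: "(LINT x|lebesgue_on E. (v x + c *\<^sub>R w x) \<bullet> grad \<phi> x + (d x + c * d' x) * \<phi> x) =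
      (\<Sum>e\<in>edges M E. edge_sign M E e * edge_integral M e (\<lambda>x. (g e x + c * g' e x) * \<phi> x))"
    if s: "smooth \<phi>" for \<phi>
  proof -
    note I = integrable_inner_continuous[OF _ smooth_continuous_grad[OF s] E(2)]
      and I' = integrable_mult_continuous[OF _ smooth_continuous[OF s] E(2)]
      and I'' = integrable_edge_mult_continuous[OF _ smooth_continuous[OF s]]
    have "(LINT x|lebesgue_on E. (v x + c *\<^sub>R w x) \<bullet> grad \<phi> x + (d x + c * d' x) * \<phi> x)
       = (LINT x|lebesgue_on E. (v x \<bullet> grad \<phi> x + d x * \<phi> x) + c * (w x \<bullet> grad \<phi> x + d' x * \<phi> x))"
      by (simp add: inner_add_left algebra_simps)
    also have "\<dots> = (LINT x|lebesgue_on E. (v x \<bullet> grad \<phi> x + d x * \<phi> x))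
        + c * (LINT x|lebesgue_on E. (w x \<bullet> grad \<phi> x + d' x * \<phi> x))"
      using I[OF v(1)] I[OF w(1)] I'[OF di(1)] I'[OF di(2)]
      by (subst Bochner_Integration.integral_add) auto
    also have "\<dots> = (\<Sum>e\<in>edges M E. edge_sign M E e *
        (edge_integral M e (\<lambda>x. g e x * \<phi> x) + c * edge_integral M e (\<lambda>x. g' e x * \<phi> x)))"
      unfolding dg[OF s] dg'[OF s] by (simp add: sum_distrib_left sum.distrib distrib_left mult_ac)
    also have "\<dots> = (\<Sum>e\<in>edges M E. edge_sign M E e * edge_integral M e (\<lambda>x. (g e x + c * g' e x) * \<phi> x))"
    proof (intro sum.cong refl arg_cong2[where f = "(*)"])
      fix e assume e: "e \<in> edges M E"
      have "edge_integral M e (\<lambda>x. (g e x + c * g' e x) * \<phi> x)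
         = (LINT s|edge_measure e. g e (edge_point M e s) * \<phi> (edge_point M e s)
             + c * (g' e (edge_point M e s) * \<phi> (edge_point M e s)))"
        unfolding edge_integral_def by (simp add: algebra_simps)
      also have "\<dots> = edge_integral M e (\<lambda>x. g e x * \<phi> x) + c * edge_integral M e (\<lambda>x. g' e x * \<phi> x)"
        unfolding edge_integral_def using I''[OF gi[OF e]] I''[OF gi'[OF e]] by simp
      finally show "edge_integral M e (\<lambda>x. g e x * \<phi> x) + c * edge_integral M e (\<lambda>x. g' e x * \<phi> x)
          = edge_integral M e (\<lambda>x. (g e x + c * g' e x) * \<phi> x)" by simp
    qed
    finally show ?thesis .
  qed
  have gi_sum: "integrable (edge_measure e) (\<lambda>s. g e (edge_point M e s) + c * g' e (edge_point M e s))"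
    if "e \<in> edges M E" for e
    using gi[OF that] gi'[OF that] by simp
  show ?thesis
    unfolding has_normal_trace_def using gi_sum weak_div_combination[OF E v(1) d w(1) d'] eq by blast
qed

text \<open>\<open>q\<close> is a polynomial on the open set \<open>E\<close> only and may be
  anything on the edges; the boundary values are supplied by the global polynomial
  \<open>P\<close>.\<close>

lemma has_normal_trace_polynomial:
  assumes M: "is_mesh \<Omega> M" "E \<in> elements M" and q: "q \<in> poly_fields l E"
  shows "\<exists>g. has_normal_trace M E q g"
proof -
  note E = mesh_element[OF M]
  obtain P where P: "\<And>i. real_polynomial_function (\<lambda>x. P x $ i)" "\<And>x. x \<in> E \<Longrightarrow> q x = P x"
    using poly_fields_eq_polynomial[OF q] by metis
  define d where "d = (\<lambda>x. \<Sum>i\<in>UNIV. grad (\<lambda>x. P x $ i) x $ i)"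
  \<comment> \<open>\<open>edge_sign\<close> is included here to cancel the one in
    \<open>has_normal_trace\<close>: its square is 1, whichever way the mesh normal points.\<close>
  define g where "g = (\<lambda>e x. edge_sign M E e * (\<Sum>i\<in>UNIV. green_weight M E i e x * P x $ i))"
  note Pg = real_polynomial_function_grad[OF P(1)]
  have Pc: "continuous_on UNIV (\<lambda>x. P x $ i)" for i
    by (intro smooth_continuous real_polynomial_function_smooth P(1))
  have dc: "continuous_on UNIV d" unfolding d_def
    by (intro continuous_intros smooth_continuous real_polynomial_function_smooth) (use Pg in blast)
  have Pgc: "continuous_on UNIV (grad (\<lambda>x. P x $ i))" for i
    by (intro smooth_continuous_grad real_polynomial_function_smooth P(1))
  have green: "(LINT x|lebesgue_on E. P x \<bullet> grad \<phi> x + d x * \<phi> x) =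
      (\<Sum>e\<in>edges M E. edge_integral M e (\<lambda>x. edge_sign M E e * g e x * \<phi> x))"
    if s: "smooth \<phi>" for \<phi>
  proof -
    \<comment> \<open>The gradient of \<open>P x $ i * \<phi> x\<close>. Adding the
      \<open>i\<close>-th components over \<open>i\<close> gives the integrand of Green's
      formula.\<close>
    define G where "G = (\<lambda>i x. P x $ i *\<^sub>R grad \<phi> x + \<phi> x *\<^sub>R grad (\<lambda>x. P x $ i) x)"
    have G: "GDERIV (\<lambda>x. P x $ i * \<phi> x) x :> G i x" for i x
      unfolding G_def using Pg smooth_GDERIV[OF s] by (intro GDERIV_mult) auto
    have Gc: "continuous_on UNIV (G i)" for i unfolding G_def
      by (intro continuous_intros Pc smooth_continuous[OF s] smooth_continuous_grad[OF s] Pgc)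
    have "(LINT x|lebesgue_on E. P x \<bullet> grad \<phi> x + d x * \<phi> x) = (LINT x|lebesgue_on E. (\<Sum>i\<in>UNIV. G i x $ i))"
      by (simp add: G_def d_def inner_vec_def sum_2 algebra_simps)
    also have "\<dots> = (\<Sum>i\<in>UNIV. LINT x|lebesgue_on E. G i x $ i)"
      by (intro Bochner_Integration.integral_sum integrable_continuous_lebesgue_on E continuous_intros Gc)
    also have "\<dots> = (\<Sum>i\<in>UNIV. \<Sum>e\<in>edges M E. edge_integral M e (\<lambda>x. green_weight M E i e x * (P x $ i * \<phi> x)))"
      by (simp only: integral_partial_deriv_element[OF M G Gc])
    also have "\<dots> = (\<Sum>e\<in>edges M E. \<Sum>i\<in>UNIV. edge_integral M e (\<lambda>x. green_weight M E i e x * (P x $ i * \<phi> x)))"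
      by (rule sum.swap)
    also have "\<dots> = (\<Sum>e\<in>edges M E. edge_integral M e (\<lambda>x. edge_sign M E e * g e x * \<phi> x))"
    proof (intro sum.cong refl)
      fix e
      have "(\<Sum>i\<in>UNIV. edge_integral M e (\<lambda>x. green_weight M E i e x * (P x $ i * \<phi> x)))
        = edge_integral M e (\<lambda>x. \<Sum>i\<in>UNIV. green_weight M E i e x * (P x $ i * \<phi> x))"
        unfolding edge_integral_def
        by (intro Bochner_Integration.integral_sum[symmetric] green_weight_integrable[where F = "\<lambda>x. P x $ i * \<phi> x" for i]
            E continuous_intros Pc smooth_continuous[OF s])
      also have "(\<lambda>x. \<Sum>i\<in>UNIV. green_weight M E i e x * (P x $ i * \<phi> x)) = (\<lambda>x. edge_sign M E e * g e x * \<phi> x)"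
        by (simp add: g_def mult.assoc[symmetric] edge_sign_square sum_distrib_right)
      finally show "(\<Sum>i\<in>UNIV. edge_integral M e (\<lambda>x. green_weight M E i e x * (P x $ i * \<phi> x)))
        = edge_integral M e (\<lambda>x. edge_sign M E e * g e x * \<phi> x)" .
    qed
    finally show ?thesis .
  qed
  have cong: "(LINT x|lebesgue_on E. q x \<bullet> h x + k x) = (LINT x|lebesgue_on E. P x \<bullet> h x + k x)" for h k
    using P(2) by (intro Bochner_Integration.integral_cong) auto
  have qint: "integrable (lebesgue_on E) q" by (rule poly_fields_integrable[OF E(1,2) q])
  \<comment> \<open>Test functions are supported inside the open element, so the edge terms of the
    same formula drop out.\<close>
  have div: "weak_div E q d"
    unfolding weak_div_def
  proof (intro conjI ballI)
    have "continuous_on UNIV (\<lambda>x. norm (d x) powr 2)"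
      by (simp add: powr_numeral) (intro continuous_intros dc)
    then show "d \<in> Lp_space 2 E"
      unfolding Lp_space_def
      using integrable_continuous_lebesgue_on[OF _ E(1,2)] continuous_on_UNIV_measurable_lebesgue_on[OF dc]
      by blast
    fix \<phi> assume \<phi>: "\<phi> \<in> test_functions E"
    then have s: "smooth \<phi>" and supp: "closure {x. \<phi> x \<noteq> 0} \<subseteq> E" by (auto simp: test_functions_def)
    have "\<phi> x = 0" if "x \<notin> E" for x using supp closure_subset[of "{x. \<phi> x \<noteq> 0}"] that by blast
    then have zero: "\<phi> x = 0" if "e \<in> edges M E" "x \<in> e" for e x
      using that E(1,4) by (auto simp: frontier_def interior_open)
    have "edge_integral M e (\<lambda>x. edge_sign M E e * g e x * \<phi> x) = 0" if e: "e \<in> edges M E" for e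
    proof -
      have "edge_integral M e (\<lambda>x. edge_sign M E e * g e x * \<phi> x) = (LINT s|edge_measure e. 0)"
        unfolding edge_integral_def
      proof (intro Bochner_Integration.integral_cong refl)
        fix s assume "s \<in> space (edge_measure e)"
        then have "edge_point M e s \<in> e"
          using e by (intro edge_point_mem[OF M]) (auto simp: space_edge_measure abs_le_iff)
        then show "edge_sign M E e * g e (edge_point M e s) * \<phi> (edge_point M e s) = 0"
          using zero[OF e] by simp
      qed
      then show ?thesis by simp
    qed
    then have "(LINT x|lebesgue_on E. q x \<bullet> grad \<phi> x + d x * \<phi> x) = 0"
      unfolding cong green[OF s] by simp
    moreover have "(LINT x|lebesgue_on E. q x \<bullet> grad \<phi> x + d x * \<phi> x) =
        (LINT x|lebesgue_on E. q x \<bullet> grad \<phi> x) + (LINT x|lebesgue_on E. d x * \<phi> x)"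
      by (intro Bochner_Integration.integral_add integrable_inner_continuous[OF qint]
          integrable_mult_continuous integrable_continuous_lebesgue_on
          E(1,2) dc smooth_continuous[OF s] smooth_continuous_grad[OF s])
    ultimately show "(LINT x|lebesgue_on E. q x \<bullet> grad \<phi> x) = - (LINT x|lebesgue_on E. d x * \<phi> x)"
      by simp
  qed
  have "integrable (edge_measure e) (\<lambda>s. g e (edge_point M e s))" for e
    unfolding g_def
    by (intro integrable_mult_right Bochner_Integration.integrable_sum green_weight_integrable[OF E(1) Pc])
  moreover have "(LINT x|lebesgue_on E. q x \<bullet> grad \<phi> x + d x * \<phi> x) =
      (\<Sum>e\<in>edges M E. edge_sign M E e * edge_integral M e (\<lambda>x. g e x * \<phi> x))" if "smooth \<phi>" for \<phi>
    unfolding cong green[OF that] by (simp add: edge_integral_def mult.assoc)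
  ultimately show ?thesis using div unfolding has_normal_trace_def by blast
qed

text \<open>The predicates themselves are equated, so that the choices made by
  \<open>normal_trace\<close> coincide.\<close>

lemma has_normal_trace_cong:
  assumes "\<And>x. x \<in> E \<Longrightarrow> v x = w x"
  shows "has_normal_trace M E v = has_normal_trace M E w"
proof -
  have "(LINT x|lebesgue_on E. v x \<bullet> h x + k x) = (LINT x|lebesgue_on E. w x \<bullet> h x + k x)" for h k
    using assms by (intro Bochner_Integration.integral_cong) auto
  moreover have "(LINT x|lebesgue_on E. v x \<bullet> h x) = (LINT x|lebesgue_on E. w x \<bullet> h x)" for h
    using assms by (intro Bochner_Integration.integral_cong) auto
  then have "weak_div E v = weak_div E w" by (intro ext) (simp add: weak_div_def)
  ultimately show ?thesis by (intro ext) (simp add: has_normal_trace_def)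
qed

text \<open>Used because the projection of a sum is known to be the sum of the projections on
  \<open>E\<close> only.\<close>

lemma dof_cong:
  assumes "\<And>x. x \<in> E \<Longrightarrow> v x = w x"
  shows "dof M E v i = dof M E w i"
proof (cases i)
  case (Edge_Dof e \<alpha>)
  then show ?thesis using has_normal_trace_cong[OF assms] by (simp add: normal_trace_def)
next
  case (Grad_Dof \<alpha>)
  have "(LINT x|lebesgue_on E. v x \<bullet> h x) = (LINT x|lebesgue_on E. w x \<bullet> h x)" for h
    using assms by (intro Bochner_Integration.integral_cong) auto
  then show ?thesis by (simp add: Grad_Dof)
next
  case (Perp_Dof \<alpha>)
  have "(LINT x|lebesgue_on E. (v x \<bullet> h x) * k x) = (LINT x|lebesgue_on E. (w x \<bullet> h x) * k x)" for h k
    using assms by (intro Bochner_Integration.integral_cong) auto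
  then show ?thesis by (simp add: Perp_Dof)
qed

section \<open>Uniqueness of the normal trace\<close>

lemma integral_mult_tendsto:
  fixes h :: "'a \<Rightarrow> real"
  assumes h: "integrable \<mu> h" and p: "\<And>n. p n \<in> borel_measurable \<mu>" "q \<in> borel_measurable \<mu>"
    and bound: "\<And>n x. x \<in> space \<mu> \<Longrightarrow> \<bar>p n x\<bar> \<le> B"
    and lim: "AE x in \<mu>. (\<lambda>n. p n x) \<longlonglongrightarrow> q x"
  shows "(\<lambda>n. LINT x|\<mu>. h x * p n x) \<longlonglongrightarrow> (LINT x|\<mu>. h x * q x)"
proof (rule integral_dominated_convergence)
  show "integrable \<mu> (\<lambda>x. B * \<bar>h x\<bar>)" using h by simp
  show "AE x in \<mu>. (\<lambda>n. h x * p n x) \<longlonglongrightarrow> h x * q x"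
    using lim by eventually_elim (rule tendsto_mult_left)
  show "AE x in \<mu>. norm (h x * p n x) \<le> B * \<bar>h x\<bar>" for n
  proof (rule AE_I2)
    fix x assume "x \<in> space \<mu>"
    then show "norm (h x * p n x) \<le> B * \<bar>h x\<bar>"
      using mult_left_mono[OF bound[of x n], of "\<bar>h x\<bar>"] by (simp add: abs_mult mult.commute)
  qed
qed (use h p in auto)

text \<open>Test functions which are polynomial and concentrate on a closed set: by the Weierstrass theorem they
  approximate \<open>m x * max 0 (1 - n * infdist x e)\<close>. Polynomials suffice as test functions for the
  normal trace, since those are not required to vanish on the boundary.\<close>

lemma polynomials_concentrating_on_closed:
  fixes m :: "'a::euclidean_space \<Rightarrow> real"
  assumes K: "compact K" and e: "closed e" "e \<noteq> {}" and m: "continuous_on UNIV m"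
  obtains p B where "\<And>n. real_polynomial_function (p n)" "\<And>n x. x \<in> K \<Longrightarrow> \<bar>p n x\<bar> \<le> B"
    "\<And>x. x \<in> K \<Longrightarrow> (\<lambda>n. p n x) \<longlonglongrightarrow> indicator e x * m x"
proof -
  define c where "c = (\<lambda>n x. m x * max 0 (1 - real n * infdist x e))"
  have "continuous_on K (c n)" for n
    unfolding c_def by (intro continuous_intros continuous_on_subset[OF m]) auto
  then have "\<exists>p. real_polynomial_function p \<and> (\<forall>x\<in>K. \<bar>c n x - p x\<bar> < 1 / real (Suc n))" for n
    by (rule Stone_Weierstrass_real_polynomial_function[OF K, of "c n" "1 / real (Suc n)"]) auto
  then obtain p where p: "\<And>n. real_polynomial_function (p n)"
    "\<And>n x. x \<in> K \<Longrightarrow> \<bar>c n x - p n x\<bar> < 1 / real (Suc n)" by metis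
  obtain B where B: "\<And>x. x \<in> K \<Longrightarrow> \<bar>m x\<bar> \<le> B"
    using continuous_on_UNIV_bounded_image[OF m compact_imp_bounded[OF K]] by (auto simp: bounded_iff)
  show thesis
  proof (rule that)
    fix n x assume x: "x \<in> K"
    have "\<bar>c n x\<bar> \<le> B * 1"
      unfolding c_def abs_mult using B[OF x] infdist_nonneg[of x e]
      by (intro mult_mono) (auto simp: max_def)
    moreover have "1 / real (Suc n) \<le> 1" by simp
    ultimately show "\<bar>p n x\<bar> \<le> B + 1" using p(2)[OF x, of n] by linarith
  next
    fix x assume x: "x \<in> K"
    have "(\<lambda>n. c n x) \<longlonglongrightarrow> indicator e x * m x"
    proof (cases "x \<in> e")
      case True
      then show ?thesis by (simp add: c_def)
    next
      case False
      then have "infdist x e > 0" using e infdist_pos_not_in_closed by blast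
      have "\<forall>\<^sub>F n in sequentially. 1 / infdist x e < real n"
        by (rule eventually_gt_at_top[THEN filterlim_real_sequentially[unfolded filterlim_iff, rule_format]])
      then have "\<forall>\<^sub>F n in sequentially. c n x = 0"
      proof eventually_elim
        case (elim n)
        then have "1 < real n * infdist x e" using \<open>infdist x e > 0\<close> by (simp add: field_simps)
        then show ?case by (simp add: c_def)
      qed
      then show ?thesis using False by (simp add: tendsto_eventually)
    qed
    moreover have "(\<lambda>n. c n x - p n x) \<longlonglongrightarrow> 0"
    proof (rule Lim_null_comparison)
      show "\<forall>\<^sub>F n in sequentially. norm (c n x - p n x) \<le> 1 / real (Suc n)"
        using p(2)[OF x] by (intro always_eventually) (auto intro: less_imp_le)
      show "(\<lambda>n. 1 / real (Suc n)) \<longlonglongrightarrow> 0"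
        using LIMSEQ_inverse_real_of_nat by (simp add: inverse_eq_divide)
    qed
    ultimately have "(\<lambda>n. c n x - (c n x - p n x)) \<longlonglongrightarrow> indicator e x * m x - 0"
      by (rule tendsto_diff)
    then show "(\<lambda>n. p n x) \<longlonglongrightarrow> indicator e x * m x" by simp
  qed (use p in auto)
qed

text \<open>Along these test functions the area integrals vanish in the limit, because an edge lies outside the
  open element, and so do the integrals over the other edges, which meet \<open>e\<close> in null sets only.\<close>

lemma has_normal_trace_unique:
  assumes M: "is_mesh \<Omega> M" "E \<in> elements M" and e: "e \<in> edges M E"
    and v: "integrable (lebesgue_on E) v"
    and tr: "has_normal_trace M E v g" "has_normal_trace M E v g'"
    and m: "continuous_on UNIV m"
  shows "edge_integral M e (\<lambda>x. g e x * m x) = edge_integral M e (\<lambda>x. g' e x * m x)"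
proof -
  note E = mesh_element[OF M]
  from tr(1) obtain d where gi: "\<And>e. e \<in> edges M E \<Longrightarrow> integrable (edge_measure e) (\<lambda>s. g e (edge_point M e s))"
    and d: "weak_div E v d" and
    dg: "\<And>\<phi>. smooth \<phi> \<Longrightarrow> (LINT x|lebesgue_on E. v x \<bullet> grad \<phi> x + d x * \<phi> x) =
           (\<Sum>e\<in>edges M E. edge_sign M E e * edge_integral M e (\<lambda>x. g e x * \<phi> x))"
    unfolding has_normal_trace_def by auto
  from tr(2) obtain d' where gi': "\<And>e. e \<in> edges M E \<Longrightarrow> integrable (edge_measure e) (\<lambda>s. g' e (edge_point M e s))"
    and d': "weak_div E v d'" and
    dg': "\<And>\<phi>. smooth \<phi> \<Longrightarrow> (LINT x|lebesgue_on E. v x \<bullet> grad \<phi> x + d' x * \<phi> x) =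
           (\<Sum>e\<in>edges M E. edge_sign M E e * edge_integral M e (\<lambda>x. g' e x * \<phi> x))"
    unfolding has_normal_trace_def by auto
  have di: "integrable (lebesgue_on E) d" "integrable (lebesgue_on E) d'"
    using d d' Lp_space_2_integrable[OF _ E(1,2)] by (auto simp: weak_div_def)
  \<comment> \<open>The two traces may be witnessed by different representatives of the weak
    divergence. Their difference is carried along; its integrals against the test functions chosen
    below tend to 0.\<close>
  define D where "D = (\<lambda>x. d x - d' x)"
  define h where "h = (\<lambda>e x. g e x - g' e x)"
  have Di: "integrable (lebesgue_on E) D" unfolding D_def using di by simp
  have hi: "integrable (edge_measure e) (\<lambda>s. h e (edge_point M e s))" if "e \<in> edges M E" for e
    unfolding h_def using gi[OF that] gi'[OF that] by simp
  have edge_diff: "edge_integral M e (\<lambda>x. h e x * \<phi> x) =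
      edge_integral M e (\<lambda>x. g e x * \<phi> x) - edge_integral M e (\<lambda>x. g' e x * \<phi> x)"
    if "e \<in> edges M E" "continuous_on UNIV \<phi>" for e \<phi>
    using integrable_edge_mult_continuous[OF gi[OF that(1)] that(2)]
      integrable_edge_mult_continuous[OF gi'[OF that(1)] that(2)]
    by (simp add: edge_integral_def h_def left_diff_distrib)
  have id: "(LINT x|lebesgue_on E. D x * \<phi> x) =
      (\<Sum>e\<in>edges M E. edge_sign M E e * edge_integral M e (\<lambda>x. h e x * \<phi> x))"
    if s: "smooth \<phi>" for \<phi>
  proof -
    note I = integrable_inner_continuous[OF v smooth_continuous_grad[OF s] E(2)]
      and I' = integrable_mult_continuous[OF _ smooth_continuous[OF s] E(2)]
    have "(LINT x|lebesgue_on E. D x * \<phi> x) =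
        (LINT x|lebesgue_on E. (v x \<bullet> grad \<phi> x + d x * \<phi> x) - (v x \<bullet> grad \<phi> x + d' x * \<phi> x))"
      by (simp add: D_def left_diff_distrib)
    also have "\<dots> = (LINT x|lebesgue_on E. v x \<bullet> grad \<phi> x + d x * \<phi> x)
        - (LINT x|lebesgue_on E. v x \<bullet> grad \<phi> x + d' x * \<phi> x)"
      using I I'[OF di(1)] I'[OF di(2)] by (intro Bochner_Integration.integral_diff) auto
    also have "\<dots> = (\<Sum>e\<in>edges M E. edge_sign M E e * edge_integral M e (\<lambda>x. h e x * \<phi> x))"
      unfolding dg[OF s] dg'[OF s] sum_subtractf[symmetric]
      by (intro sum.cong refl) (simp add: edge_diff smooth_continuous[OF s] right_diff_distrib)
    finally show ?thesis .
  qed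
  have sub: "e' \<subseteq> frontier E" if "e' \<in> edges M E" for e' using E(4) that by blast
  have "e = edge_point M e ` {- (edge_length e / 2)..edge_length e / 2}"
    by (rule mesh_edge_geometry(3)[OF M e])
  moreover have "compact (edge_point M e ` {- (edge_length e / 2)..edge_length e / 2})"
    by (intro compact_continuous_image continuous_on_subset[OF edge_point_continuous]) auto
  moreover have "edge_point M e ` {- (edge_length e / 2)..edge_length e / 2} \<noteq> {}"
    using mesh_edge_geometry(2)[OF M e] by simp
  ultimately have e_closed: "closed e" "e \<noteq> {}" by (metis compact_imp_closed)+
  obtain p B where p: "\<And>n. real_polynomial_function (p n)"
    and B: "\<And>n x. x \<in> closure E \<Longrightarrow> \<bar>p n x\<bar> \<le> B"
    and lim: "\<And>x. x \<in> closure E \<Longrightarrow> (\<lambda>n. p n x) \<longlonglongrightarrow> indicator e x * m x"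
    using polynomials_concentrating_on_closed[of "closure E" e m] E(2) e_closed m
    by (metis compact_closure)
  have pc: "continuous_on UNIV (p n)" for n
    by (intro smooth_continuous real_polynomial_function_smooth p)
  have out: "x \<notin> e" if "x \<in> E" for x
    using sub[OF e] that E(1) by (auto simp: frontier_def interior_open)
  have "(\<lambda>n. LINT x|lebesgue_on E. D x * p n x) \<longlonglongrightarrow> (LINT x|lebesgue_on E. D x * 0)"
  proof (rule integral_mult_tendsto[OF Di])
    show "p n \<in> borel_measurable (lebesgue_on E)" for n
      by (rule continuous_on_UNIV_measurable_lebesgue_on[OF pc])
    show "\<bar>p n x\<bar> \<le> B" if "x \<in> space (lebesgue_on E)" for n x
      using that B closure_subset by auto
    show "AE x in lebesgue_on E. (\<lambda>n. p n x) \<longlonglongrightarrow> 0"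
    proof (rule AE_I2)
      fix x assume "x \<in> space (lebesgue_on E)"
      then have "x \<in> E" by simp
      then show "(\<lambda>n. p n x) \<longlonglongrightarrow> 0" using lim[of x] out[of x] closure_subset by auto
    qed
  qed simp
  then have "(\<lambda>n. LINT x|lebesgue_on E. D x * p n x) \<longlonglongrightarrow> 0" by simp
  moreover have "(\<lambda>n. LINT x|lebesgue_on E. D x * p n x) \<longlonglongrightarrow>
      edge_sign M E e * edge_integral M e (\<lambda>x. h e x * m x)"
  proof -
    have "(\<lambda>n. edge_integral M e' (\<lambda>x. h e' x * p n x)) \<longlonglongrightarrow>
        (if e' = e then edge_integral M e (\<lambda>x. h e x * m x) else 0)" if e': "e' \<in> edges M E" for e'
    proof -
      let ?q = "\<lambda>s. if e' = e then m (edge_point M e' s) else 0"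
      have pt: "edge_point M e' s \<in> e'" if "s \<in> space (edge_measure e')" for s
        using that by (intro edge_point_mem[OF M e']) (auto simp: space_edge_measure abs_le_iff)
      have "(\<lambda>n. LINT s|edge_measure e'. h e' (edge_point M e' s) * p n (edge_point M e' s))
          \<longlonglongrightarrow> (LINT s|edge_measure e'. h e' (edge_point M e' s) * ?q s)"
      proof (rule integral_mult_tendsto[OF hi[OF e']])
        show "(\<lambda>s. p n (edge_point M e' s)) \<in> borel_measurable (edge_measure e')" for n
          using continuous_on_compose2[OF pc edge_point_continuous]
          by (intro edge_measure_measurable borel_measurable_continuous_onI) simp
        have "(\<lambda>s. m (edge_point M e' s)) \<in> borel_measurable (edge_measure e')"
          using continuous_on_compose2[OF m edge_point_continuous]
          by (intro edge_measure_measurable borel_measurable_continuous_onI) simp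
        then show "?q \<in> borel_measurable (edge_measure e')" by (cases "e' = e") auto
        show "\<bar>p n (edge_point M e' s)\<bar> \<le> B" if "s \<in> space (edge_measure e')" for n s
          using pt[OF that] sub[OF e'] by (intro B) (auto simp: frontier_def)
        have null: "{- (edge_length e' / 2), edge_length e' / 2} \<in> null_sets lebesgue"
          by (intro null_sets_completionI finite_imp_null_set_lborel) simp
        have "AE s in lebesgue. s \<notin> {- (edge_length e' / 2), edge_length e' / 2}"
          by (rule AE_not_in[OF null])
        then have "AE s in edge_measure e'. s \<notin> {- (edge_length e' / 2), edge_length e' / 2}"
          unfolding edge_measure_def by (subst AE_restrict_space_iff) auto
        then show "AE s in edge_measure e'. (\<lambda>n. p n (edge_point M e' s)) \<longlonglongrightarrow> ?q s"
          using AE_space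
        proof eventually_elim
          case (elim s)
          note pt = pt[OF elim(2)]
          have "e' = e" if "edge_point M e' s \<in> e"
          proof (rule ccontr)
            assume "e' \<noteq> e"
            then have "\<bar>s\<bar> = edge_length e' / 2"
              using mesh_edges_cross[OF M e' e _ pt that] by simp
            with elim(1) show False by auto
          qed
          then have "indicator e (edge_point M e' s) * m (edge_point M e' s) = ?q s"
            using pt by (auto simp: indicator_def)
          moreover have "edge_point M e' s \<in> closure E"
            using pt sub[OF e'] by (auto simp: frontier_def)
          ultimately show ?case using lim by metis
        qed
      qed
      then show ?thesis unfolding edge_integral_def by (cases "e' = e") simp_all
    qed
    then have "(\<lambda>n. \<Sum>e'\<in>edges M E. edge_sign M E e' * edge_integral M e' (\<lambda>x. h e' x * p n x)) \<longlonglongrightarrow>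
        (\<Sum>e'\<in>edges M E. edge_sign M E e' * (if e' = e then edge_integral M e (\<lambda>x. h e x * m x) else 0))"
      by (intro tendsto_sum tendsto_mult_left)
    also have "(\<Sum>e'\<in>edges M E. edge_sign M E e' * (if e' = e then edge_integral M e (\<lambda>x. h e x * m x) else 0))
        = (\<Sum>e'\<in>edges M E. if e' = e then edge_sign M E e * edge_integral M e (\<lambda>x. h e x * m x) else 0)"
      by (intro sum.cong) auto
    also have "\<dots> = edge_sign M E e * edge_integral M e (\<lambda>x. h e x * m x)"
      using E(3) e by simp
    finally show ?thesis by (simp add: id real_polynomial_function_smooth[OF p])
  qed
  ultimately have "edge_sign M E e * edge_integral M e (\<lambda>x. h e x * m x) = 0"
    using LIMSEQ_unique by blast
  then have "edge_integral M e (\<lambda>x. h e x * m x) = 0" by (simp add: edge_sign_def split: if_splits)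
  then show ?thesis using edge_diff[OF e m] by simp
qed


section \<open>Coercivity of the shifted form\<close>

text \<open>At \<open>z = 0\<close> both sides vanish, so the negative exponent \<open>q - 2\<close>
  that occurs for \<open>q < 2\<close> does no harm.\<close>

lemma powr_mult_square:
  fixes z :: real
  assumes "0 \<le> z"
  shows "z powr (q - 2) * z\<^sup>2 = z powr q"
proof (cases "z = 0")
  case False
  with assms have "z\<^sup>2 = z powr 2" by (simp add: powr_numeral)
  then show ?thesis by (metis powr_add diff_add_cancel)
qed simp

text \<open>\<open>x\<close>, \<open>y\<close>, \<open>t\<close> stand for the norms of
  \<open>w\<close>, of the sum and of the shift, and \<open>b\<close> for the pairing of the sum
  with \<open>w\<close>. Stated for numbers, the bound serves both pointwise under an integral and
  for vectors of degrees of freedom.\<close>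

lemma shifted_power_bound:
  fixes q x y t b :: real
  assumes q: "1 < q" and x: "0 \<le> x" and y: "0 \<le> y" and t: "0 \<le> t"
    and b: "y\<^sup>2 - y * t \<le> b" and tri: "x \<le> y + t"
  shows "2 powr (- q - 1) * (x powr (q - 2) * x\<^sup>2) - (1 / 2 + 2 powr q) * (t powr (q - 2) * t\<^sup>2)
    \<le> y powr (q - 2) * b"
proof -
  \<comment> \<open>A case distinction in place of Young's inequality: a small shift
    \<open>t \<le> y / 2\<close> is absorbed by half of the leading term, otherwise \<open>y\<close>
    is at most \<open>2 * t\<close>.\<close>
  have "y powr (q - 1) * t \<le> y powr q / 2 + 2 powr q * t powr q"
  proof (cases "t \<le> y / 2")
    case True
    have "y powr (q - 1) * t \<le> y powr (q - 1) * (y / 2)"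
      using True by (intro mult_left_mono) auto
    also have "\<dots> = y powr q / 2"
      using y by (cases "y = 0") (simp_all add: powr_diff)
    finally show ?thesis using t by (smt (verit) mult_nonneg_nonneg powr_ge_zero)
  next
    case False
    then have "y powr (q - 1) * t \<le> (2 * t) powr (q - 1) * t"
      using y t q by (intro mult_right_mono powr_mono2) auto
    also have "\<dots> = 2 powr (q - 1) * t powr q"
      using t by (cases "t = 0") (simp_all add: powr_mult powr_diff)
    also have "\<dots> \<le> 2 powr q * t powr q"
      by (intro mult_right_mono powr_mono) auto
    finally show ?thesis using powr_ge_zero[of y q] by linarith
  qed
  moreover have "y powr (q - 2) * (y * t) = y powr (q - 1) * t"
  proof (cases "y = 0")
    case False
    with y have "y powr (q - 1) = y powr (q - 2) * y powr 1"
      by (metis powr_add diff_add_eq_diff_diff_swap add.commute diff_add_cancel one_add_one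
          add_diff_cancel_left' diff_diff_add)
    with False y show ?thesis by simp
  qed simp
  moreover have "y powr (q - 2) * (y\<^sup>2 - y * t) \<le> y powr (q - 2) * b"
    using b by (intro mult_left_mono) auto
  ultimately have 1: "y powr q / 2 - 2 powr q * t powr q \<le> y powr (q - 2) * b"
    by (simp only: right_diff_distrib powr_mult_square[OF y])
  \<comment> \<open>From \<open>x \<le> 2 * max y t\<close>. The factor
    \<open>2 powr (- q - 1)\<close> scales the result to the remaining half of
    \<open>y powr q\<close>, at the price of \<open>t powr q / 2\<close>; this is the 1/2 in the
    constant, while \<open>2 powr q\<close> comes from the case of a large shift.\<close>
  have "x powr q \<le> (2 * max y t) powr q"
    using q x tri y by (intro powr_mono2) auto
  also have "\<dots> = 2 powr q * max y t powr q"
    using y t by (simp add: powr_mult)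
  also have "\<dots> \<le> 2 powr q * (y powr q + t powr q)"
    by (intro mult_left_mono) (auto simp: max_def)
  finally have "2 powr (- q - 1) * x powr q \<le> 2 powr (- q - 1) * (2 powr q * (y powr q + t powr q))"
    by (intro mult_left_mono) auto
  also have "\<dots> = (2 powr (- q - 1) * 2 powr q) * (y powr q + t powr q)" by simp
  also have "2 powr (- q - 1) * 2 powr q = (1 / 2 :: real)"
    by (simp flip: powr_add add: powr_minus)
  finally have "2 powr (- q - 1) * x powr q \<le> y powr q / 2 + t powr q / 2" by simp
  with 1 show ?thesis
    by (simp add: powr_mult_square[OF x] powr_mult_square[OF t] distrib_right)
qed

text \<open>In terms of the norm \<open>n = A w powr (1 / q)\<close> the quotient is at least
  \<open>(c * n powr q - K) / n\<close>, which tends to infinity because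
  \<open>q > 1\<close>.\<close>

lemma filterlim_superlinear_quotient:
  fixes A B :: "'a \<Rightarrow> real"
  assumes q: "1 < q" and c: "0 < c" and nonneg: "\<And>w. 0 \<le> A w"
    and bound: "\<And>w. w \<in> Z \<Longrightarrow> c * A w - K \<le> B w"
  shows "filterlim (\<lambda>w. B w / (A w powr (1 / q))) at_top
           (inf (filtercomap (\<lambda>w. A w powr (1 / q)) at_top) (principal Z))"
    (is "filterlim _ _ ?F")
proof -
  let ?N = "\<lambda>w. A w powr (1 / q)"
  have N: "filterlim ?N at_top ?F"
    by (intro filterlim_inf filterlim_filtercomap filterlim_mono[OF filterlim_filtercomap]) auto
  have "filterlim (\<lambda>n. (c * n powr q - K) / n) at_top at_top"
    using q c by real_asymp
  then have "filterlim (\<lambda>w. (c * ?N w powr q - K) / ?N w) at_top ?F"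
    using N by (rule filterlim_compose)
  moreover have "eventually (\<lambda>w. (c * ?N w powr q - K) / ?N w \<le> B w / ?N w) ?F"
  proof -
    have "eventually (\<lambda>w. w \<in> Z) ?F" by (simp add: eventually_inf_principal)
    then show ?thesis
    proof eventually_elim
      case (elim w)
      have "?N w powr q = A w" using q nonneg[of w] by (simp add: powr_powr)
      then show ?case using bound[OF elim] by (simp add: divide_right_mono)
    qed
  qed
  ultimately show ?thesis by (rule filterlim_at_top_mono)
qed

section \<open>Shifted bounds for the two local forms\<close>

lemma dof_norm_eq_L2_set: "dof_norm M k E v = L2_set (dof M E v) (dof_indices M k E)"
  by (simp add: dof_norm_def dof_inner_def L2_set_def power2_eq_square)

text \<open>The scalar bound in the Euclidean space of vectors of degrees of freedom. Additivity is
  assumed index by index, because the residuals themselves add up on \<open>E\<close> only.\<close>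

lemma s_loc_shifted_bound:
  assumes q: "1 < q"
    and add: "\<And>i. i \<in> dof_indices M k E \<Longrightarrow> dof M E y i = dof M E x i + dof M E t i"
  shows "2 powr (- q - 1) * s_loc M k q E x x - (1 / 2 + 2 powr q) * s_loc M k q E t t
    \<le> s_loc M k q E y x"
proof -
  let ?I = "dof_indices M k E"
  let ?n = "dof_norm M k E"
  have sq: "dof_inner M k E v v = (?n v)\<^sup>2" for v
    unfolding dof_norm_def dof_inner_def by (simp add: sum_nonneg)
  have "dof_inner M k E y x = dof_inner M k E y y - dof_inner M k E y t"
    unfolding dof_inner_def by (simp add: add sum_subtractf[symmetric] algebra_simps)
  moreover have "dof_inner M k E y t \<le> ?n y * ?n t"
  proof -
    have "dof_inner M k E y t \<le> (\<Sum>i\<in>?I. \<bar>dof M E y i\<bar> * \<bar>dof M E t i\<bar>)"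
      unfolding dof_inner_def by (intro sum_mono) (simp flip: abs_mult)
    also have "\<dots> \<le> ?n y * ?n t" unfolding dof_norm_eq_L2_set by (rule L2_set_mult_ineq)
    finally show ?thesis .
  qed
  ultimately have b: "(?n y)\<^sup>2 - ?n y * ?n t \<le> dof_inner M k E y x" by (simp add: sq)
  have "?n x = L2_set (\<lambda>i. dof M E y i + - dof M E t i) ?I"
    unfolding dof_norm_eq_L2_set by (intro L2_set_cong) (simp_all add: add)
  also have "\<dots> \<le> L2_set (dof M E y) ?I + L2_set (\<lambda>i. - dof M E t i) ?I"
    by (rule L2_set_triangle_ineq)
  also have "L2_set (\<lambda>i. - dof M E t i) ?I = ?n t"
    unfolding dof_norm_eq_L2_set by (simp add: L2_set_def)
  finally have tri: "?n x \<le> ?n y + ?n t" by (simp add: dof_norm_eq_L2_set)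
  have "0 \<le> ?n v" for v unfolding dof_norm_eq_L2_set by (rule L2_set_nonneg)
  from mult_left_mono[OF shifted_power_bound[OF q this this this b tri], of "(diameter E)\<^sup>2"]
  show ?thesis unfolding s_loc_def sq by (simp add: algebra_simps)
qed

text \<open>The scalar bound is applied at each point and then integrated; boundedness of the
  fields, which are polynomial in the application, makes all integrands integrable.\<close>

lemma a_loc_shifted_bound:
  assumes q: "1 < q" and y: "\<And>z. z \<in> E \<Longrightarrow> y z = x z + t z"
    and E: "E \<in> lmeasurable"
    and x: "x \<in> borel_measurable (lebesgue_on E)" "bounded (x ` E)"
    and t: "t \<in> borel_measurable (lebesgue_on E)" "bounded (t ` E)"
  shows "2 powr (- q - 1) * a_loc q E x x - (1 / 2 + 2 powr q) * a_loc q E t t \<le> a_loc q E y x"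
proof -
  let ?\<mu> = "lebesgue_on E"
  interpret finite_measure ?\<mu> by (rule finite_measure_lebesgue_on[OF E])
  have int: "integrable ?\<mu> (\<lambda>z. norm (u z) powr (q - 2) * (u z \<bullet> v z))"
    if u: "u \<in> borel_measurable ?\<mu>" "bounded (u ` E)"
      and v: "v \<in> borel_measurable ?\<mu>" "bounded (v ` E)" for u v :: "pt \<Rightarrow> pt"
  proof -
    from u v obtain a b where ab: "\<And>z. z \<in> E \<Longrightarrow> norm (u z) \<le> a" "\<And>z. z \<in> E \<Longrightarrow> norm (v z) \<le> b"
      by (auto simp: bounded_iff)
    have "\<bar>norm (u z) powr (q - 2) * (u z \<bullet> v z)\<bar> \<le> a powr (q - 1) * b" if "z \<in> E" for z
    proof -
      have "\<bar>norm (u z) powr (q - 2) * (u z \<bullet> v z)\<bar> \<le> norm (u z) powr (q - 2) * (norm (u z) * norm (v z))"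
        by (simp add: abs_mult mult_left_mono Cauchy_Schwarz_ineq2)
      \<comment> \<open>For \<open>q < 2\<close> the factor with exponent \<open>q - 2\<close> is
        unbounded near zeros of \<open>u\<close>. One factor \<open>norm (u z)\<close> from the
        inner product raises the exponent to \<open>q - 1 > 0\<close>.\<close>
      also have "\<dots> = norm (u z) powr (q - 1) * norm (v z)"
      proof (cases "u z = 0")
        case False
        then have "norm (u z) powr (q - 2) * norm (u z) powr 1 = norm (u z) powr (q - 1)"
          by (simp only: powr_add[symmetric]) (simp add: algebra_simps)
        with False show ?thesis by simp
      qed simp
      also have "\<dots> \<le> a powr (q - 1) * b"
        using ab[OF that] q by (intro mult_mono powr_mono2) auto
      finally show ?thesis .
    qed
    then show ?thesis using u v
      by (intro integrable_const_bound[where B="a powr (q - 1) * b"]) auto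
  qed
  have ym: "y \<in> borel_measurable ?\<mu>"
    by (subst measurable_cong[of _ _ "\<lambda>z. x z + t z"]) (use x t y in auto)
  have yb: "bounded (y ` E)"
  proof -
    have "y ` E = (\<lambda>z. x z + t z) ` E" using y by auto
    then show ?thesis using bounded_plus_comp[OF x(2) t(2)] by simp
  qed
  have "2 powr (- q - 1) * a_loc q E x x - (1 / 2 + 2 powr q) * a_loc q E t t =
     (LINT z|?\<mu>. 2 powr (- q - 1) * (norm (x z) powr (q - 2) * (x z \<bullet> x z))
         - (1 / 2 + 2 powr q) * (norm (t z) powr (q - 2) * (t z \<bullet> t z)))"
    unfolding a_loc_def using int[OF x x] int[OF t t] by simp
  also have "\<dots> \<le> a_loc q E y x"
    unfolding a_loc_def
  proof (intro integral_mono)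
    fix z assume "z \<in> space ?\<mu>"
    then have yz: "y z = x z + t z" using y by simp
    have "y z \<bullet> x z = y z \<bullet> y z - y z \<bullet> t z" by (simp add: yz algebra_simps)
    then have b: "(norm (y z))\<^sup>2 - norm (y z) * norm (t z) \<le> y z \<bullet> x z"
      using norm_cauchy_schwarz[of "y z" "t z"] by (simp add: power2_norm_eq_inner)
    have "norm (x z) \<le> norm (y z) + norm (t z)"
      using norm_triangle_ineq4[of "y z" "t z"] by (simp add: yz)
    from shifted_power_bound[OF q _ _ _ b this]
    show "2 powr (- q - 1) * (norm (x z) powr (q - 2) * (x z \<bullet> x z))
         - (1 / 2 + 2 powr q) * (norm (t z) powr (q - 2) * (t z \<bullet> t z))
       \<le> norm (y z) powr (q - 2) * (y z \<bullet> x z)"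
      by (simp add: power2_norm_eq_inner)
  qed (use int x t ym yb in auto)
  finally show ?thesis .
qed

section \<open>Additivity of the degrees of freedom\<close>

lemma real_polynomial_function_scaled_mono: "real_polynomial_function (scaled_mono E \<alpha>)"
proof -
  have "real_polynomial_function (\<lambda>x. ((x - barycenter E) /\<^sub>R diameter E) $ i)" for i
  proof -
    have "(\<lambda>x. ((x - barycenter E) /\<^sub>R diameter E) $ i) =
        (\<lambda>x. inverse (diameter E) * (x $ i + - (barycenter E $ i)))" by auto
    then show ?thesis
      by (simp only:) (intro real_polynomial_function.intros(2-4) real_polynomial_function_component)
  qed
  then show ?thesis unfolding scaled_mono_def[abs_def] mono2_def
    by (intro real_polynomial_function.intros(4) real_polynomial_function_power)
qed

text \<open>The moments over \<open>E\<close> are linear as integrals. On an edge the chosen traces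
  need not add up as functions; but the sum of two chosen traces is a trace of the sum, and
  uniqueness identifies its edge moments with those of the chosen one.\<close>

lemma dof_add:
  assumes M: "is_mesh \<Omega> M" "E \<in> elements M" and i: "i \<in> dof_indices M k E"
    and v: "integrable (lebesgue_on E) v" "has_normal_trace M E v g"
    and w: "integrable (lebesgue_on E) w" "has_normal_trace M E w g'"
  shows "dof M E (\<lambda>x. v x + w x) i = dof M E v i + dof M E w i"
proof (cases i)
  case (Edge_Dof e \<alpha>)
  then have e: "e \<in> edges M E" using i by (auto simp: dof_indices_def)
  note E = mesh_element[OF M]
  have trace: "has_normal_trace M E u (normal_trace M E u)" if "has_normal_trace M E u g" for u g
    unfolding normal_trace_def by (rule someI[of "has_normal_trace M E u", OF that])
  let ?m = "\<lambda>x. (edge_coord M e x / edge_length e) ^ \<alpha>"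
  have m: "continuous_on UNIV ?m"
    unfolding edge_coord_def by (intro continuous_intros) (use mesh_edge_geometry(2)[OF M e] in auto)
  note I = integrable_edge_mult_continuous[OF _ m]
  have int: "integrable (edge_measure e) (\<lambda>s. normal_trace M E u e (edge_point M e s))"
    if "has_normal_trace M E u g" for u g
    using trace[OF that] e unfolding has_normal_trace_def by blast
  have sum: "has_normal_trace M E (\<lambda>x. v x + w x)
      (\<lambda>e x. normal_trace M E v e x + normal_trace M E w e x)"
    using has_normal_trace_combination[OF E(1,2) v(1) trace[OF v(2)] w(1) trace[OF w(2)], of 1] by simp
  have "edge_integral M e (\<lambda>x. normal_trace M E (\<lambda>x. v x + w x) e x * ?m x)
      = edge_integral M e (\<lambda>x. (normal_trace M E v e x + normal_trace M E w e x) * ?m x)"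
    using v(1) w(1) by (intro has_normal_trace_unique[OF M e _ trace[OF sum] sum m]) auto
  also have "\<dots> = edge_integral M e (\<lambda>x. normal_trace M E v e x * ?m x)
      + edge_integral M e (\<lambda>x. normal_trace M E w e x * ?m x)"
    using I[OF int[OF v(2)]] I[OF int[OF w(2)]] by (simp add: edge_integral_def distrib_right)
  finally show ?thesis by (simp add: Edge_Dof add_divide_distrib)
next
  case (Grad_Dof \<alpha>)
  have "continuous_on UNIV (grad (scaled_mono E \<alpha>))"
    by (intro smooth_continuous_grad real_polynomial_function_smooth real_polynomial_function_scaled_mono)
  note I = integrable_inner_continuous[OF _ this mesh_element(2)[OF M]]
  show ?thesis using I[OF v(1)] I[OF w(1)] by (simp add: Grad_Dof inner_add_left distrib_left)
next
  case (Perp_Dof \<alpha>)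
  \<comment> \<open>All factors other than the field are collected into one continuous weight, so
    that the integrand is an inner product with it.\<close>
  define h where "h = (\<lambda>x. scaled_mono E \<alpha> x *\<^sub>R perp ((x - barycenter E) /\<^sub>R diameter E))"
  have "continuous_on UNIV (scaled_mono E \<alpha>)"
    by (intro smooth_continuous real_polynomial_function_smooth real_polynomial_function_scaled_mono)
  moreover have "continuous_on UNIV (\<lambda>x. perp ((x - barycenter E) /\<^sub>R diameter E))"
  proof (rule continuous_on_vec_components)
    have "continuous_on UNIV (\<lambda>x. ((x - barycenter E) /\<^sub>R diameter E) $ j)" for j
      by (intro continuous_intros)
    then show "continuous_on UNIV (\<lambda>x. perp ((x - barycenter E) /\<^sub>R diameter E) $ i)" for i
      using exhaust_2[of i] by (elim disjE) (simp_all only: perp_nth continuous_on_minus)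
  qed
  ultimately have "continuous_on UNIV h" unfolding h_def by (intro continuous_intros)
  note I = integrable_inner_continuous[OF _ this mesh_element(2)[OF M]]
  have eq: "(u \<bullet> perp ((x - barycenter E) /\<^sub>R diameter E)) * scaled_mono E \<alpha> x = u \<bullet> h x" for u x
    by (simp add: h_def)
  show ?thesis
    unfolding Perp_Dof dof.simps eq
    unfolding inner_add_left Bochner_Integration.integral_add[OF I[OF v(1)] I[OF w(1)]]
    by (rule distrib_left)
qed

lemma V_loc_integrable: "open E \<Longrightarrow> bounded E \<Longrightarrow> v \<in> V_loc M k E \<Longrightarrow> integrable (lebesgue_on E) v"
  by (intro Lp_space_2_integrable) (auto simp: V_loc_def H_div_def)

lemma V_loc_residual:
  assumes M: "is_mesh \<Omega> M" "E \<in> elements M" and v: "v \<in> V_loc M k E"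
  shows "integrable (lebesgue_on E) (\<lambda>x. v x - L2_proj k E v x)"
    and "\<exists>g. has_normal_trace M E (\<lambda>x. v x - L2_proj k E v x) g"
proof -
  note E = mesh_element[OF M]
  have vi: "integrable (lebesgue_on E) v" by (rule V_loc_integrable[OF E(1,2) v])
  note p = L2_proj_properties(1)[OF E(1,2) vi]
  note pi = poly_fields_integrable(1)[OF E(1,2) p]
  show "integrable (lebesgue_on E) (\<lambda>x. v x - L2_proj k E v x)" using vi pi by simp
  from v obtain g where g: "has_normal_trace M E v g" by (auto simp: V_loc_def)
  from has_normal_trace_polynomial[OF M p] obtain g' where "has_normal_trace M E (L2_proj k E v) g'" ..
  from has_normal_trace_combination[OF E(1,2) vi g pi this, of "- 1"]
  show "\<exists>g. has_normal_trace M E (\<lambda>x. v x - L2_proj k E v x) g" by auto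
qed

section \<open>The bound for the global form and the conclusion\<close>

text \<open>Both local bounds come with the same constants, depending on \<open>q\<close> only, and
  can therefore be added over all elements.\<close>

lemma a_h_shifted_bound:
  assumes q: "1 < q" and M: "is_mesh \<Omega> M"
    and w: "\<And>E. E \<in> elements M \<Longrightarrow> w \<in> V_loc M k E" and t: "\<And>E. E \<in> elements M \<Longrightarrow> t \<in> V_loc M k E"
  shows "2 powr (- q - 1) * a_h M k q w w - (1 / 2 + 2 powr q) * a_h M k q t t
    \<le> a_h M k q (\<lambda>x. w x + t x) w"
proof -
  let ?r = "\<lambda>E v x. v x - L2_proj k E v x"
  let ?y = "\<lambda>x. w x + t x"
  have a: "2 powr (- q - 1) * a_loc q E (L2_proj k E w) (L2_proj k E w)
      - (1 / 2 + 2 powr q) * a_loc q E (L2_proj k E t) (L2_proj k E t)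
      \<le> a_loc q E (L2_proj k E ?y) (L2_proj k E w)" if E: "E \<in> elements M" for E
  proof -
    note ob = mesh_element(1,2)[OF M E]
    note wi = V_loc_integrable[OF ob w[OF E]] and ti = V_loc_integrable[OF ob t[OF E]]
    note P = poly_fields_integrable[OF ob L2_proj_properties(1)[OF ob wi]]
      poly_fields_integrable[OF ob L2_proj_properties(1)[OF ob ti]]
    show ?thesis
      using P by (intro a_loc_shifted_bound q L2_proj_add ob wi ti lmeasurable_open_bounded) auto
  qed
  have s: "2 powr (- q - 1) * s_loc M k q E (?r E w) (?r E w)
      - (1 / 2 + 2 powr q) * s_loc M k q E (?r E t) (?r E t)
      \<le> s_loc M k q E (?r E ?y) (?r E w)" if E: "E \<in> elements M" for E
  proof (rule s_loc_shifted_bound[OF q])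
    note ob = mesh_element(1,2)[OF M E]
    note wi = V_loc_integrable[OF ob w[OF E]] and ti = V_loc_integrable[OF ob t[OF E]]
    fix i assume i: "i \<in> dof_indices M k E"
    from V_loc_residual(2)[OF M E w[OF E]] V_loc_residual(2)[OF M E t[OF E]] obtain g g' where
      "has_normal_trace M E (?r E w) g" "has_normal_trace M E (?r E t) g'" by blast
    then have "dof M E (\<lambda>x. ?r E w x + ?r E t x) i = dof M E (?r E w) i + dof M E (?r E t) i"
      by (intro dof_add[OF M E i] V_loc_residual(1)[OF M E] w t E)
    moreover have "dof M E (?r E ?y) i = dof M E (\<lambda>x. ?r E w x + ?r E t x) i"
      by (rule dof_cong) (simp add: L2_proj_add[OF ob wi ti])
    ultimately show "dof M E (?r E ?y) i = dof M E (?r E w) i + dof M E (?r E t) i" by simp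
  qed
  have "2 powr (- q - 1) * a_h M k q w w - (1 / 2 + 2 powr q) * a_h M k q t t =
    (\<Sum>E\<in>elements M. 2 powr (- q - 1) * (a_loc q E (L2_proj k E w) (L2_proj k E w) + s_loc M k q E (?r E w) (?r E w))
      - (1 / 2 + 2 powr q) * (a_loc q E (L2_proj k E t) (L2_proj k E t) + s_loc M k q E (?r E t) (?r E t)))"
    unfolding a_h_def by (simp only: sum_distrib_left sum_subtractf)
  also have "\<dots> \<le> a_h M k q ?y w"
    unfolding a_h_def
  proof (rule sum_mono)
    fix E assume "E \<in> elements M"
    from a[OF this] s[OF this]
    show "2 powr (- q - 1) * (a_loc q E (L2_proj k E w) (L2_proj k E w) + s_loc M k q E (?r E w) (?r E w))
      - (1 / 2 + 2 powr q) * (a_loc q E (L2_proj k E t) (L2_proj k E t) + s_loc M k q E (?r E t) (?r E t))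
      \<le> a_loc q E (L2_proj k E ?y) (L2_proj k E w) + s_loc M k q E (?r E ?y) (?r E w)"
      unfolding distrib_left by linarith
  qed
  finally show ?thesis .
qed

lemma a_h_nonneg: "0 \<le> a_h M k q w w"
proof -
  have "0 \<le> dof_inner M k E u u" for E u unfolding dof_inner_def by (intro sum_nonneg) simp
  then show ?thesis
    unfolding a_h_def a_loc_def s_loc_def
    by (intro sum_nonneg add_nonneg_nonneg Bochner_Integration.integral_nonneg mult_nonneg_nonneg) auto
qed

theorem lemma32:
  fixes \<Omega> :: "pt set" and \<M> :: "mesh set" and M :: mesh and p :: real and k :: nat
    and f :: "pt \<Rightarrow> real" and \<tau> :: "pt \<Rightarrow> pt"
  assumes "polygonal_lipschitz_domain \<Omega>"
    and "1 < p"
    and "regular_mesh_family \<Omega> \<M>"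
    and "M \<in> \<M>"
    and "f \<in> Lp_space (conj_exponent p) \<Omega>"
    and "\<tau> \<in> K_set \<Omega> M k f"
  shows "filterlim
           (\<lambda>w. shifted_op M k (conj_exponent p) \<tau> w w / a_h_norm M k (conj_exponent p) w)
           at_top
           (inf (filtercomap (a_h_norm M k (conj_exponent p)) at_top) (principal (Z_h \<Omega> M k)))"
proof -
  let ?q = "conj_exponent p"
  have q: "1 < ?q" using \<open>1 < p\<close> by (simp add: conj_exponent_def)
  have M: "is_mesh \<Omega> M" using assms(3,4) by (simp add: regular_mesh_family_def)
  have \<tau>: "\<tau> \<in> V_loc M k E" if "E \<in> elements M" for E
    using assms(6) that by (auto simp: K_set_def V_h_def)
  \<comment> \<open>The subtracted term involves \<open>\<tau>\<close> and not \<open>w\<close>: it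
    is the fixed number \<open>K\<close> of the growth lemma.\<close>
  have bound: "2 powr (- ?q - 1) * a_h M k ?q w w - (1 / 2 + 2 powr ?q) * a_h M k ?q \<tau> \<tau>
      \<le> shifted_op M k ?q \<tau> w w" if w: "w \<in> Z_h \<Omega> M k" for w
  proof -
    have "w \<in> V_loc M k E" if "E \<in> elements M" for E
      using w that by (auto simp: Z_h_def V_h_def)
    from a_h_shifted_bound[OF q M this \<tau>] show ?thesis by (simp add: shifted_op_def)
  qed
  show ?thesis
    using filterlim_superlinear_quotient[OF q _ a_h_nonneg bound]
    unfolding a_h_norm_def[abs_def] by simp
qed

end
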